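(* Let $\beta>1$ and let $(Z(t),t\ge0)$ be the pure death process with $Z(0)=\infty$, absorbing state $1$ and death rates $\lambda_n=n^\beta L(n)$, $n\ge2$, where $L:[1,\infty)\to(0,\infty)$ is slowly varying at infinity. Let $T_n$, $A_n$, $v(t)$, and the functions $I$ and $J$ on $(0,\infty)$ be as defined in the context. (i) If $x\ge1$, then $$n^{-1}\log\mathbb{P}(T_n>xA_n)\to-I(x),\quad n\to\infty,$$ $$v(t)^{-1}\log\mathbb{P}(Z(t)>xv(t))\to-J(x),\quad t\to0.$$ (ii) If $0<x\le1$, then $$n^{-1}\log\mathbb{P}(T_n<xA_n)\to-I(x),\quad n\to\infty,$$ $$v(t)^{-1}\log\mathbb{P}(Z(t)<xv(t))\to-J(x),\quad t\to0.$$
   Context: Construction of the process: since $\beta>1$, $\sum_{n\ge2}\lambda_n^{-1}<\infty$. Let $X_2,X_3,\ldots$ be independent exponential random variables with $\mathbb{E}X_i=\lambda_i^{-1}$ (the holding times), and $T_n=\sum_{i=n+1}^\infty X_i$ for $n\ge1$ (the hitting time of state $n$). Then $Z(0)=\infty$, $Z(t)=n$ for $T_n\le t<T_{n-1}$, $n\ge2$, and $Z(t)=1$ for $t\ge T_1$; thus $\{Z(t)>n\}=\{T_n>t\}$. $A_n=\mathbb{E}T_n=\sum_{i=n+1}^\infty\lambda_i^{-1}$. The speed of coming down from infinity is the step function $v(t)=n$ for $t\in[A_n,A_{n-1})$, $n\ge2$, and $v(t)=1$ for $t\ge A_1$. The limit $t\to0$ is along $t>0$. For $x>0$, $\tau(x)\in(-\infty,(\beta-1)^{-1})$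 is the unique solution $\tau$ of $$\int_1^\infty\frac{dy}{(\beta-1)^{-1}y^\beta-\tau}=x,$$ and $$I(x)=-(\beta-1)x\tau(x)-\ln\big(1-(\beta-1)\tau(x)\big),\qquad J(x)=x\,I(x^{\beta-1}).$$ *)

theory Defs
  imports "HOL-Probability.Probability"
begin

text \<open>Measurability is part of the standard (Karamata) notion. Only the values of \<open>L\<close>
  on \<open>[1, \<infinity>)\<close> matter: for \<open>c < 1\<close> the argument \<open>c * x\<close> is eventually in this range.\<close>

definition slowly_varying :: "(real \<Rightarrow> real) \<Rightarrow> bool" where
  "slowly_varying L \<longleftrightarrow>
     L \<in> borel_measurable (restrict_space borel {1..}) \<and>
     (\<forall>x\<ge>1. L x > 0) \<and>
     (\<forall>c>0. ((\<lambda>x. L (c * x) / L x) \<longlongrightarrow> 1) at_top)"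

text \<open>\<open>X i\<close> is the holding time in state \<open>i \<ge> 2\<close>. The series converges
  almost surely if the mean holding times are summable.\<close>

definition hitting_time :: "(nat \<Rightarrow> 'a \<Rightarrow> real) \<Rightarrow> nat \<Rightarrow> 'a \<Rightarrow> real" where
  "hitting_time X n \<omega> = (\<Sum>k. X (n + 1 + k) \<omega>)"

text \<open>Almost surely the hitting times are positive and decrease strictly to \<open>0\<close>, so for
  \<open>t > 0\<close> exactly one \<open>n\<close> qualifies. On the exceptional null set, \<open>LEAST\<close> and the final
  \<open>\<infinity>\<close> keep the process measurable.\<close>

definition death_process :: "(nat \<Rightarrow> 'a \<Rightarrow> real) \<Rightarrow> real \<Rightarrow> 'a \<Rightarrow> enat" where
  "death_process X t \<omega> =
     (if t = 0 then \<infinity>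
      else if hitting_time X 1 \<omega> \<le> t then 1
      else if \<exists>n\<ge>2. hitting_time X n \<omega> \<le> t \<and> t < hitting_time X (n - 1) \<omega>
        then enat (LEAST n. n \<ge> 2 \<and> hitting_time X n \<omega> \<le> t \<and> t < hitting_time X (n - 1) \<omega>)
      else \<infinity>)"

definition mean_hitting_time :: "'a measure \<Rightarrow> (nat \<Rightarrow> 'a \<Rightarrow> real) \<Rightarrow> nat \<Rightarrow> real" where
  "mean_hitting_time M X n = integral\<^sup>L M (hitting_time X n)"

text \<open>Meaningful for \<open>t > 0\<close> only, where \<open>n\<close> is unique if the mean hitting times decrease
  strictly to \<open>0\<close>.\<close>

definition speed :: "'a measure \<Rightarrow> (nat \<Rightarrow> 'a \<Rightarrow> real) \<Rightarrow> real \<Rightarrow> nat" where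
  "speed M X t =
     (if mean_hitting_time M X 1 \<le> t then 1
      else (LEAST n. n \<ge> 2 \<and> mean_hitting_time M X n \<le> t \<and> t < mean_hitting_time M X (n - 1)))"

definition tau :: "real \<Rightarrow> real \<Rightarrow> real" where
  "tau \<beta> x = (THE \<tau>. \<tau> < 1 / (\<beta> - 1) \<and>
     ((\<lambda>y. 1 / (y powr \<beta> / (\<beta> - 1) - \<tau>)) has_integral x) {1..})"

definition rate_I :: "real \<Rightarrow> real \<Rightarrow> real" where
  "rate_I \<beta> x = - (\<beta> - 1) * x * tau \<beta> x - ln (1 - (\<beta> - 1) * tau \<beta> x)"

definition rate_J :: "real \<Rightarrow> real \<Rightarrow> real" where
  "rate_J \<beta> x = x * rate_I \<beta> (x powr (\<beta> - 1))"

end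

theory Submission
  imports Defs
begin

text \<open>
  Put \<open>Y\<^sub>n = \<lambda>\<^sub>n T\<^sub>n / n\<close>. Since \<open>T\<^sub>n\<close> is a sum of independent exponential variables,
  \<open>n\<^sup>-\<^sup>1 ln E exp (n s Y\<^sub>n) = - n\<^sup>-\<^sup>1 \<Sum>\<^bsub>i>n\<^esub> ln (1 - s \<lambda>\<^sub>n / \<lambda>\<^sub>i)\<close> for \<open>s < 1\<close>. Because
  \<open>\<lambda>\<^sub>n / \<lambda>\<^sub>i\<close> is close to \<open>(i / n)\<close> to the power \<open>-\<beta>\<close>, this Riemann sum tends to
  \<open>\<Lambda> s = - \<integral> ln (1 - s y powr -\<beta>) dy\<close> over \<open>[1, \<infinity>)\<close>; Potter bounds for \<open>L\<close>
  give the domination. Likewise \<open>E Y\<^sub>n\<close> tends to \<open>1 / (\<beta> - 1)\<close>. A Gaertner--Ellis argument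
  gives the tail rate \<open>s \<Lambda>' s - \<Lambda> s\<close> at level \<open>\<Lambda>' s = \<integral> dy / (y powr \<beta> - s)\<close>, and integration
  by parts turns it into \<open>I\<close>, with \<open>s = (\<beta> - 1) \<tau>\<close>. The statements on \<open>Z\<close> follow from
  \<open>{Z t > m} = {T\<^sub>m > t}\<close> with \<open>m \<approx> x v(t)\<close>, for which \<open>t / A\<^sub>m\<close> tends to
  \<open>x powr (\<beta> - 1)\<close> by regular variation.
\<close>

section \<open>Slowly varying functions\<close>

text \<open>Slow variation is only a pointwise statement for each fixed factor, while the moment
  sums and the comparison of \<open>m\<close> with \<open>v(t)\<close> move two arguments at once;
  measurability upgrades it to uniformity, from which the Potter bounds follow. Time is measured in
  units of \<open>n / \<lambda>\<^sub>n\<close> rather than \<open>A\<^sub>n\<close>, so that only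
  ratios of rates occur; the level \<open>x\<close> becomes \<open>x / (\<beta> - 1)\<close>, and
  \<open>x = 1\<close> corresponds to the exponent \<open>s = 0\<close>. The lower bound tilts at
  exponents slightly above \<open>s\<close>, so \<open>s\<close> must be interior to the domain
  \<open>s < 1\<close>. It always is: the slope of the limiting cumulant function blows up at 1,
  hence every level is attained below 1. Lower tails are upper tails of \<open>- Y\<^sub>n\<close>.
  The transfer to \<open>Z\<close> dictates the form of the tail statements: a strict event for
  \<open>Z\<close> can become a weak one for \<open>T\<^sub>m\<close>, the integer \<open>m\<close>
  varies with \<open>t\<close>, and \<open>t\<close> meets its intended level only asymptotically.
  They are therefore proved along an arbitrary filter, for thresholds that merely converge, and for
  any quantity squeezed between the strict and the weak probability.\<close>

text \<open>The argument of Csiszar and Erdos: if uniformity fails along points \<open>x\<^sub>n\<close> with shifts \<open>u\<^sub>n\<close>,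
  then the shifts that are good from \<open>x\<^sub>n\<close> and those that are good from \<open>x\<^sub>n + u\<^sub>n\<close> both
  eventually fill most of an interval, so they reach a common point.\<close>

lemma uniform_convergence_shift:
  fixes h :: "real \<Rightarrow> real"
  assumes h [measurable]: "h \<in> borel_measurable borel"
    and lim: "\<And>u. u \<ge> 0 \<Longrightarrow> ((\<lambda>x. h (x + u) - h x) \<longlongrightarrow> 0) at_top"
    and "\<epsilon> > 0"
  obtains X0 where "\<And>x u. x \<ge> X0 \<Longrightarrow> 0 \<le> u \<Longrightarrow> u \<le> 1 \<Longrightarrow> \<bar>h (x + u) - h x\<bar> < \<epsilon>"
proof (rule ccontr)
  assume "\<not> thesis"
  then have "\<forall>n::nat. \<exists>x u. x \<ge> real n \<and> 0 \<le> u \<and> u \<le> 1 \<and> \<not> \<bar>h (x + u) - h x\<bar> < \<epsilon>"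
    using that by meson
  then obtain x u where xn: "\<And>n::nat. x n \<ge> real n" and u: "\<And>n. 0 \<le> u n" "\<And>n. u n \<le> 1"
    and far: "\<And>n. \<not> \<bar>h (x n + u n) - h (x n)\<bar> < \<epsilon>"
    by metis
  \<comment> \<open>Pointwise convergence makes the sets \<open>V n\<close> of shifts that are good
    from index \<open>n\<close> on increase to the whole interval, so their measure eventually
    exceeds any fraction of \<open>r\<close> below 1.\<close>
  have full: "\<exists>n. measure lborel {v \<in> {0..r}. \<forall>m\<ge>n. \<bar>h (z m + v) - h (z m)\<bar> < \<epsilon> / 2} > 3 / 4 * r"
    if z: "\<And>n::nat. z n \<ge> real n" and "r > 0" for z :: "nat \<Rightarrow> real" and r :: real
  proof -
    define V where "V n = {v \<in> {0..r}. \<forall>m\<ge>n. \<bar>h (z m + v) - h (z m)\<bar> < \<epsilon> / 2}" for n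
    have meas: "V n \<in> sets lborel" for n
      unfolding V_def by measurable
    have inc: "incseq V"
      by (auto simp: V_def incseq_def)
    have z_top: "filterlim z at_top sequentially"
      by (rule filterlim_at_top_mono[OF filterlim_real_sequentially]) (simp add: z)
    have "(\<Union>n. V n) = {0..r}"
    proof (intro equalityI subsetI)
      fix v assume v: "v \<in> {0..r}"
      have "((\<lambda>n. h (z n + v) - h (z n)) \<longlonglongrightarrow> 0)"
        using filterlim_compose[OF lim z_top] v by simp
      then have "\<forall>\<^sub>F n in sequentially. \<bar>h (z n + v) - h (z n)\<bar> < \<epsilon> / 2"
        using tendstoD[of _ 0 _ "\<epsilon> / 2"] \<open>\<epsilon> > 0\<close> by (fastforce simp: dist_real_def)
      then show "v \<in> (\<Union>n. V n)"
        using v by (auto simp: V_def eventually_sequentially)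
    qed (auto simp: V_def)
    moreover have "(\<lambda>n. measure lborel (V n)) \<longlonglongrightarrow> measure lborel (\<Union>n. V n)"
    proof (rule Lim_measure_incseq)
      show "range V \<subseteq> sets lborel" using meas by auto
      show "emeasure lborel (\<Union>i. V i) \<noteq> \<infinity>"
        unfolding calculation using \<open>r > 0\<close> by simp
    qed (rule inc)
    ultimately have "(\<lambda>n. measure lborel (V n)) \<longlonglongrightarrow> r"
      using \<open>r > 0\<close> by simp
    then have "\<forall>\<^sub>F n in sequentially. measure lborel (V n) > 3 / 4 * r"
      using \<open>r > 0\<close> by (intro order_tendstoD) auto
    then show ?thesis
      unfolding V_def eventually_sequentially by blast
  qed
  define y where "y n = x n + u n" for n
  have yn: "y n \<ge> real n" for n
    using xn[of n] u(1)[of n] by (simp add: y_def)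
  \<comment> \<open>The lengths 2 and 1 differ because a shift in \<open>[0, 1]\<close> from
    \<open>y n\<close> is a shift by at most 2 from \<open>x n\<close>. Inside \<open>[0, 2]\<close>
    the good sets have measures above 3/2 and 3/4, too much to be disjoint.\<close>
  obtain p where p: "measure lborel {v \<in> {0..2}. \<forall>m\<ge>p. \<bar>h (x m + v) - h (x m)\<bar> < \<epsilon> / 2} > 3 / 4 * 2"
    using full[of x 2] xn by auto
  obtain q where q: "measure lborel {v \<in> {0..1}. \<forall>m\<ge>q. \<bar>h (y m + v) - h (y m)\<bar> < \<epsilon> / 2} > 3 / 4 * 1"
    using full[of y 1] yn by auto
  define n where "n = max p q"
  define V where "V = {v \<in> {0..2}. \<bar>h (x n + v) - h (x n)\<bar> < \<epsilon> / 2}"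
  define W where "W = {v \<in> {0..1}. \<bar>h (y n + v) - h (y n)\<bar> < \<epsilon> / 2}"
  define W' where "W' = {v. v - u n \<in> W}"
  have [measurable]: "V \<in> sets borel" "W \<in> sets borel"
    unfolding V_def W_def by measurable
  have [measurable]: "W' \<in> sets borel"
    unfolding W'_def by measurable
  have fin: "A \<in> fmeasurable lborel" if "A \<subseteq> {0..2}" "A \<in> sets borel" for A :: "real set"
    by (rule fmeasurableI2[of "{0..2}"]) (use that in \<open>auto intro: fmeasurableI\<close>)
  have subs: "V \<subseteq> {0..2}" "W \<subseteq> {0..2}" "W' \<subseteq> {0..2}"
    using u(1)[of n] u(2)[of n] by (auto simp: V_def W_def W'_def)
  have V: "measure lborel V > 3 / 2"
  proof -
    have "measure lborel {v \<in> {0..2}. \<forall>m\<ge>p. \<bar>h (x m + v) - h (x m)\<bar> < \<epsilon> / 2} \<le> measure lborel V"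
      using subs by (intro measure_mono_fmeasurable fin) (auto simp: V_def n_def)
    then show ?thesis using p by simp
  qed
  have W: "measure lborel W > 3 / 4"
  proof -
    have "measure lborel {v \<in> {0..1}. \<forall>m\<ge>q. \<bar>h (y m + v) - h (y m)\<bar> < \<epsilon> / 2} \<le> measure lborel W"
      using subs by (intro measure_mono_fmeasurable fin) (auto simp: W_def n_def)
    then show ?thesis using q by simp
  qed
  have "emeasure lborel W = emeasure lborel W'"
  proof -
    have "emeasure lborel W = emeasure (distr lborel borel ((+) (- u n))) W"
      by (simp add: lborel_distr_plus)
    also have "\<dots> = emeasure lborel ((+) (- u n) -` W \<inter> space lborel)"
      by (rule emeasure_distr) auto
    also have "(+) (- u n) -` W \<inter> space lborel = W'"
      by (auto simp: W'_def)
    finally show ?thesis .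
  qed
  then have W': "measure lborel W' > 3 / 4"
    using W by (simp add: measure_def)
  have "V \<inter> W' \<noteq> {}"
  proof
    assume disj: "V \<inter> W' = {}"
    have "W' - V = W'" using disj by auto
    then have "measure lborel V + measure lborel W' = measure lborel (V \<union> W')"
      using subs measure_Un2[of V lborel W'] fin by simp
    also have "\<dots> \<le> measure lborel {0..2::real}"
      using subs by (intro measure_mono_fmeasurable fin) auto
    also have "\<dots> = 2" by simp
    finally show False using V W' by simp
  qed
  then obtain v where "v \<in> V" "v - u n \<in> W"
    by (auto simp: W'_def)
  then have "\<bar>h (x n + v) - h (x n)\<bar> < \<epsilon> / 2" "\<bar>h (x n + v) - h (x n + u n)\<bar> < \<epsilon> / 2"
    by (auto simp: V_def W_def y_def)
  then show False
    using far[of n] by linarith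
qed

text \<open>For \<open>h x = ln (L (exp x))\<close> slow variation says that increments vanish, and
  uniformity bounds every step of length at most 1 by \<open>\<delta>\<close>. Chaining unit steps
  gives growth at most linear in \<open>ln (y / x)\<close>; the extra 1 pays for the fractional
  step.\<close>

lemma slowly_varying_Potter:
  assumes L: "slowly_varying L" and "\<delta> > 0"
  obtains X0 where "X0 \<ge> 1"
    "\<And>x y. x \<ge> X0 \<Longrightarrow> x \<le> y \<Longrightarrow> \<bar>ln (L y) - ln (L x)\<bar> \<le> \<delta> * (1 + ln (y / x))"
proof -
  have meas: "L \<in> borel_measurable (restrict_space borel {1..})"
    and pos: "\<And>x. x \<ge> 1 \<Longrightarrow> L x > 0"
    and lim: "\<And>c. c > 0 \<Longrightarrow> ((\<lambda>x. L (c * x) / L x) \<longlongrightarrow> 1) at_top"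
    using L unfolding slowly_varying_def by auto
  \<comment> \<open>\<open>L\<close> is measurable only on \<open>[1, \<infinity>)\<close>.
    Extension by 0 gives a Borel function on the line, and \<open>exp x\<close> lies in the original
    range once \<open>x \<ge> 0\<close>.\<close>
  define L' where "L' x = (if x \<in> {1..} then L x else 0)" for x :: real
  have [measurable]: "L' \<in> borel_measurable borel"
    using meas unfolding L'_def by (subst (asm) measurable_restrict_space_iff) auto
  define h where "h x = ln (L' (exp x))" for x
  have [measurable]: "h \<in> borel_measurable borel"
    unfolding h_def by measurable
  have h_eq: "h x = ln (L (exp x))" if "x \<ge> 0" for x
    using that by (simp add: h_def L'_def)
  have hlim: "((\<lambda>x. h (x + u) - h x) \<longlongrightarrow> 0) at_top" if "u \<ge> 0" for u
  proof -
    have "((\<lambda>x. L (exp u * exp x) / L (exp x)) \<longlongrightarrow> 1) at_top"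
      using filterlim_compose[OF lim[of "exp u"] exp_at_top] by simp
    then have "((\<lambda>x. ln (L (exp u * exp x) / L (exp x))) \<longlongrightarrow> ln 1) at_top"
      by (rule tendsto_ln) simp
    moreover have "\<forall>\<^sub>F x in at_top. ln (L (exp u * exp x) / L (exp x)) = h (x + u) - h x"
      using eventually_ge_at_top[of 0]
    proof eventually_elim
      case (elim x)
      have "exp u * exp x \<ge> 1" "exp x \<ge> 1"
        using elim that by (auto simp flip: exp_add)
      then show ?case
        using pos[of "exp u * exp x"] pos[of "exp x"] elim that
        by (simp add: h_eq ln_div exp_add mult.commute)
    qed
    ultimately show ?thesis
      using tendsto_cong by force
  qed
  obtain X1 where X1: "\<And>x u. x \<ge> X1 \<Longrightarrow> 0 \<le> u \<Longrightarrow> u \<le> 1 \<Longrightarrow> \<bar>h (x + u) - h x\<bar> < \<delta>"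
    using uniform_convergence_shift[OF _ hlim \<open>\<delta> > 0\<close>] by auto
  have steps: "\<bar>h (x + real k + u) - h x\<bar> \<le> \<delta> * (real k + 1)"
    if "x \<ge> X1" "0 \<le> u" "u \<le> 1" for x u and k :: nat
    using that
  proof (induction k arbitrary: u)
    case 0
    then show ?case using X1[of x u] by simp
  next
    case (Suc k)
    have "\<bar>h (x + real k + 1) - h x\<bar> \<le> \<delta> * (real k + 1)"
      using Suc.IH[of 1] Suc.prems by simp
    moreover have "\<bar>h (x + real k + 1 + u) - h (x + real k + 1)\<bar> < \<delta>"
      using X1[of "x + real k + 1" u] Suc.prems by simp
    ultimately show ?case
      by (simp add: algebra_simps)
  qed
  have lin: "\<bar>h (x + u) - h x\<bar> \<le> \<delta> * (1 + u)" if "x \<ge> X1" "u \<ge> 0" for x u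
  proof -
    define k where "k = nat \<lfloor>u\<rfloor>"
    have "0 \<le> u - real k" "u - real k \<le> 1" "real k \<le> u"
      unfolding k_def using \<open>u \<ge> 0\<close> by linarith+
    then have "\<bar>h (x + u) - h x\<bar> \<le> \<delta> * (real k + 1)"
      using steps[of x "u - real k" k] that by simp
    also have "\<dots> \<le> \<delta> * (1 + u)"
      using \<open>\<delta> > 0\<close> \<open>real k \<le> u\<close> by simp
    finally show ?thesis .
  qed
  show ?thesis
  proof (rule that[of "exp (max 0 X1)"])
    fix x y :: real
    assume x: "x \<ge> exp (max 0 X1)" and "x \<le> y"
    have x0: "x > 0" using x exp_gt_zero[of "max 0 X1"] by linarith
    then have "ln x \<ge> max 0 X1"
      using x by (simp only: ln_ge_iff)
    then have lx: "ln x \<ge> X1" "ln x \<ge> 0"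
      by auto
    have ly: "ln y \<ge> 0" "ln x + ln (y / x) = ln y" "ln (y / x) \<ge> 0"
      using \<open>x \<le> y\<close> x0 lx by (auto simp: ln_div intro: order_trans)
    show "\<bar>ln (L y) - ln (L x)\<bar> \<le> \<delta> * (1 + ln (y / x))"
      using lin[of "ln x" "ln (y / x)"] lx ly x0 \<open>x \<le> y\<close> by (simp add: h_eq)
  qed simp
qed

section \<open>Tails from logarithmic moment generating functions\<close>

text \<open>The exponentially tilted lower bound of large deviation theory. The tilted mass of
  \<open>{Y \<le> a}\<close> and of \<open>{Y \<ge> b}\<close> is estimated by the moments at the neighbouring exponents
  \<open>r\<close> and \<open>t\<close>, so the tilted measure itself is not needed.\<close>

lemma (in prob_space) prob_greater_ge_exponential_moments:
  fixes Y :: "'a \<Rightarrow> real"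
  assumes [measurable]: "random_variable borel Y"
    and int: "integrable M (\<lambda>\<omega>. exp (r * Y \<omega>))" "integrable M (\<lambda>\<omega>. exp (s * Y \<omega>))"
      "integrable M (\<lambda>\<omega>. exp (t * Y \<omega>))"
    and "0 \<le> s" "r \<le> s" "s \<le> t"
  shows "exp (- s * b) * (expectation (\<lambda>\<omega>. exp (s * Y \<omega>))
      - exp ((s - r) * a) * expectation (\<lambda>\<omega>. exp (r * Y \<omega>))
      - exp ((s - t) * b) * expectation (\<lambda>\<omega>. exp (t * Y \<omega>)))
    \<le> prob {\<omega> \<in> space M. Y \<omega> > a}"
proof -
  have meas: "{\<omega> \<in> space M. Y \<omega> > a} \<in> events"
    by measurable
  have "exp (- s * b) * (expectation (\<lambda>\<omega>. exp (s * Y \<omega>))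
      - exp ((s - r) * a) * expectation (\<lambda>\<omega>. exp (r * Y \<omega>))
      - exp ((s - t) * b) * expectation (\<lambda>\<omega>. exp (t * Y \<omega>)))
    = expectation (\<lambda>\<omega>. exp (- s * b) * (exp (s * Y \<omega>)
      - exp ((s - r) * a) * exp (r * Y \<omega>) - exp ((s - t) * b) * exp (t * Y \<omega>)))"
    using int by simp
  also have "\<dots> \<le> expectation (indicator {\<omega> \<in> space M. Y \<omega> > a})"
  proof (rule integral_mono)
    fix \<omega> assume "\<omega> \<in> space M"
    have *: "exp (s * Y \<omega>) \<le> exp ((s - r) * a) * exp (r * Y \<omega>)" if "Y \<omega> \<le> a"
    proof -
      have "(s - r) * Y \<omega> \<le> (s - r) * a"
        using that \<open>r \<le> s\<close> by (intro mult_left_mono) auto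
      then show ?thesis
        by (simp add: algebra_simps flip: exp_add)
    qed
    have **: "exp (s * Y \<omega>) \<le> exp ((s - t) * b) * exp (t * Y \<omega>)" if "b \<le> Y \<omega>"
    proof -
      have "(t - s) * b \<le> (t - s) * Y \<omega>"
        using that \<open>s \<le> t\<close> by (intro mult_left_mono) auto
      then show ?thesis
        by (simp add: algebra_simps flip: exp_add)
    qed
    define E where "E = exp (s * Y \<omega>)"
    define R where "R = exp ((s - r) * a) * exp (r * Y \<omega>)"
    define Q where "Q = exp ((s - t) * b) * exp (t * Y \<omega>)"
    have pos: "R \<ge> 0" "Q \<ge> 0" by (auto simp: R_def Q_def)
    \<comment> \<open>Up to \<open>a\<close> the term \<open>R\<close> dominates \<open>E\<close>,
      from \<open>b\<close> on the term \<open>Q\<close> does, so the difference can be positive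
      only inside the window, where \<open>s \<ge> 0\<close> bounds \<open>E\<close> by
      \<open>exp (s * b)\<close>.\<close>
    have "E \<le> R \<or> a < Y \<omega>" "E \<le> Q \<or> Y \<omega> < b"
      using * ** by (fastforce simp: E_def R_def Q_def)+
    then have "E - R - Q \<le> (if a < Y \<omega> \<and> Y \<omega> < b then E else 0)"
      using pos by auto
    then have "exp (- s * b) * (E - R - Q) \<le> exp (- s * b) * (if a < Y \<omega> \<and> Y \<omega> < b then E else 0)"
      by (intro mult_left_mono) auto
    also have "\<dots> \<le> indicator {\<omega> \<in> space M. Y \<omega> > a} \<omega>"
    proof (cases "a < Y \<omega> \<and> Y \<omega> < b")
      case True
      then have "s * Y \<omega> \<le> s * b"
        using \<open>0 \<le> s\<close> by (intro mult_left_mono) auto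
      then have "exp (- s * b) * E \<le> 1"
        by (simp add: E_def flip: exp_add)
      then show ?thesis
        using True \<open>\<omega> \<in> space M\<close> by (simp add: indicator_def)
    qed (auto simp: indicator_def)
    finally show "exp (- s * b) * (exp (s * Y \<omega>)
      - exp ((s - r) * a) * exp (r * Y \<omega>) - exp ((s - t) * b) * exp (t * Y \<omega>))
      \<le> indicator {\<omega> \<in> space M. Y \<omega> > a} \<omega>"
      by (simp add: E_def R_def Q_def)
  qed (use int meas in \<open>auto simp: emeasure_eq_measure\<close>)
  also have "\<dots> = prob {\<omega> \<in> space M. Y \<omega> > a}"
    by simp
  finally show ?thesis .
qed

lemma (in prob_space) exponential_moment_pos:
  fixes Y :: "'a \<Rightarrow> real"
  assumes "integrable M (\<lambda>\<omega>. exp (Y \<omega>))"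
  shows "expectation (\<lambda>\<omega>. exp (Y \<omega>)) > 0"
proof -
  have "expectation (\<lambda>\<omega>. exp (Y \<omega>)) \<noteq> 0"
    using assms by (subst integral_nonneg_eq_0_iff_AE) (auto simp: AE_False)
  moreover have "expectation (\<lambda>\<omega>. exp (Y \<omega>)) \<ge> 0"
    by simp
  ultimately show ?thesis by linarith
qed

text \<open>The subgradient inequality makes \<open>\<Phi>\<close> the derivative of \<open>\<Lambda>\<close> without any
  differentiation under the integral sign.\<close>

lemma (in prob_space) upper_tail_rate:
  fixes Y :: "'i \<Rightarrow> 'a \<Rightarrow> real" and a c p :: "'i \<Rightarrow> real" and \<Lambda> \<Phi> :: "real \<Rightarrow> real"
  assumes rv: "\<forall>\<^sub>F i in F. random_variable borel (Y i)"
    and a: "filterlim a at_top F"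
    and U: "open U" "s \<in> U" and "s \<ge> 0"
    and int: "\<And>r. r \<in> U \<Longrightarrow> \<forall>\<^sub>F i in F. integrable M (\<lambda>\<omega>. exp (r * a i * Y i \<omega>))"
    and lim: "\<And>r. r \<in> U \<Longrightarrow>
      ((\<lambda>i. ln (expectation (\<lambda>\<omega>. exp (r * a i * Y i \<omega>))) / a i) \<longlongrightarrow> \<Lambda> r) F"
    and subgrad: "\<And>r t. r \<in> U \<Longrightarrow> t \<in> U \<Longrightarrow> \<Lambda> t - \<Lambda> r \<le> (t - r) * \<Phi> t"
    and mono: "strict_mono_on U \<Phi>" and cont: "continuous_on U \<Phi>"
    and c: "(c \<longlongrightarrow> \<Phi> s) F"
    and p: "\<forall>\<^sub>F i in F. prob {\<omega> \<in> space M. Y i \<omega> > c i} \<le> p i"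
      "\<forall>\<^sub>F i in F. p i \<le> prob {\<omega> \<in> space M. Y i \<omega> \<ge> c i}"
  shows "((\<lambda>i. ln (p i) / a i) \<longlongrightarrow> \<Lambda> s - s * \<Phi> s) F"
proof -
  define K where "K r i = ln (expectation (\<lambda>\<omega>. exp (r * a i * Y i \<omega>)))" for r i
  have K: "\<forall>\<^sub>F i in F. expectation (\<lambda>\<omega>. exp (r * a i * Y i \<omega>)) = exp (K r i)" if "r \<in> U" for r
    using int[OF that] by eventually_elim (simp add: K_def exponential_moment_pos)
  have Klim: "((\<lambda>i. K r i / a i) \<longlongrightarrow> \<Lambda> r) F" if "r \<in> U" for r
    using lim[OF that] by (simp add: K_def)
  have apos: "\<forall>\<^sub>F i in F. a i > 0"
    using a by (auto simp: filterlim_at_top_dense)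

  \<comment> \<open>Positivity of \<open>p i\<close> is part of the claim because the upper estimate
    takes its logarithm too.\<close>
  have low: "\<forall>\<^sub>F i in F. p i > 0 \<and> l < ln (p i) / a i" if l: "l < \<Lambda> s - s * \<Phi> s" for l
  proof -
    have isC: "isCont \<Phi> s"
      using U cont continuous_on_eq_continuous_at by blast
    have "((\<lambda>\<eta>. \<Phi> (s + 4 * \<eta>)) \<longlongrightarrow> \<Phi> s) (at_right 0)"
    proof (rule isCont_tendsto_compose[OF isC])
      show "((\<lambda>\<eta>. s + 4 * \<eta>) \<longlongrightarrow> s) (at_right 0)"
        by (auto intro!: tendsto_eq_intros)
    qed
    \<comment> \<open>The tilt will sit at \<open>s + 2 * \<eta>\<close> and the window will end at
      \<open>\<Phi> (s + 4 * \<eta>)\<close>. The resulting bound tends to the desired rate as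
      \<open>\<eta>\<close> tends to 0, so a small \<open>\<eta>\<close> beats
      \<open>l\<close>.\<close>
    then have "((\<lambda>\<eta>. \<Lambda> s + 2 * \<eta> * \<Phi> s - (s + 2 * \<eta>) * \<Phi> (s + 4 * \<eta>))
        \<longlongrightarrow> \<Lambda> s + 2 * 0 * \<Phi> s - (s + 2 * 0) * \<Phi> s) (at_right 0)"
      by (intro tendsto_intros)
    then have ev1: "\<forall>\<^sub>F \<eta> in at_right 0. \<Lambda> s + 2 * \<eta> * \<Phi> s - (s + 2 * \<eta>) * \<Phi> (s + 4 * \<eta>) > l"
      using l by (intro order_tendstoD) auto
    obtain e where e: "e > 0" "ball s e \<subseteq> U"
      using U by (auto simp: open_contains_ball)
    have ev2: "\<forall>\<^sub>F \<eta> in at_right (0::real). 0 < \<eta> \<and> \<eta> < e / 4"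
      using e(1) by (auto simp: eventually_at_right_field intro!: exI[of _ "e / 4"])
    obtain \<eta> where \<eta>: "0 < \<eta>" "\<eta> < e / 4"
      "\<Lambda> s + 2 * \<eta> * \<Phi> s - (s + 2 * \<eta>) * \<Phi> (s + 4 * \<eta>) > l"
      using eventually_happens'[OF _ eventually_conj[OF ev1 ev2]] by auto
    \<comment> \<open>The tilt at \<open>s1\<close> favours values near \<open>\<Phi> s1\<close>,
      strictly inside the window from \<open>\<Phi> s\<close> to \<open>\<Phi> s3\<close>. The
      exponents \<open>s0\<close> and \<open>s2\<close> bound the tilted mass to its left and to its
      right; strict monotonicity of \<open>\<Phi>\<close> makes both bounds decay
      exponentially.\<close>
    define s0 s1 s2 s3 where "s0 = s + \<eta>" and "s1 = s + 2 * \<eta>" and "s2 = s + 3 * \<eta>" and "s3 = s + 4 * \<eta>"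
    have inU: "s0 \<in> U" "s1 \<in> U" "s2 \<in> U" "s3 \<in> U"
      using \<eta> by (auto simp: s0_def s1_def s2_def s3_def dist_real_def intro!: subsetD[OF e(2)])
    define b where "b = \<Phi> s3"
    have "\<Phi> s < \<Phi> s0" "\<Phi> s2 < b"
      unfolding b_def using \<eta> inU U
      by (auto intro!: strict_mono_onD[OF mono] simp: s0_def s2_def s3_def)
    have "\<Lambda> s1 \<ge> \<Lambda> s + 2 * \<eta> * \<Phi> s"
      using subgrad[of s1 s] inU U by (simp add: s1_def)
    then have main: "\<Lambda> s1 - s1 * b > l"
      using \<eta> by (simp add: s1_def b_def s3_def)
    define \<kappa> where "\<kappa> = min ((s1 - s0) * (\<Phi> s0 - \<Phi> s)) ((s2 - s1) * (b - \<Phi> s2)) / 2"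
    have ord: "0 \<le> s1" "s0 < s1" "s1 < s2"
      using \<eta> \<open>s \<ge> 0\<close> by (auto simp: s0_def s1_def s2_def)
    have \<kappa>: "\<kappa> > 0" "\<kappa> < (s1 - s0) * (\<Phi> s0 - \<Phi> s)" "\<kappa> < (s2 - s1) * (b - \<Phi> s2)"
    proof -
      have "(s1 - s0) * (\<Phi> s0 - \<Phi> s) > 0" "(s2 - s1) * (b - \<Phi> s2) > 0"
        using ord \<open>\<Phi> s < \<Phi> s0\<close> \<open>\<Phi> s2 < b\<close> by auto
      then show "\<kappa> > 0" "\<kappa> < (s1 - s0) * (\<Phi> s0 - \<Phi> s)" "\<kappa> < (s2 - s1) * (b - \<Phi> s2)"
        by (auto simp: \<kappa>_def min_def)
    qed
    have "((\<lambda>i. K s0 i / a i - K s1 i / a i + (s1 - s0) * c i) \<longlongrightarrow> \<Lambda> s0 - \<Lambda> s1 + (s1 - s0) * \<Phi> s) F"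
      by (intro tendsto_intros Klim inU c)
    moreover have "\<Lambda> s0 - \<Lambda> s1 + (s1 - s0) * \<Phi> s < - \<kappa>"
      using subgrad[of s1 s0] inU \<kappa>(2) by (simp add: algebra_simps)
    ultimately have e1: "\<forall>\<^sub>F i in F. K s0 i / a i - K s1 i / a i + (s1 - s0) * c i < - \<kappa>"
      by (rule order_tendstoD)
    have "((\<lambda>i. K s2 i / a i - K s1 i / a i + (s1 - s2) * b) \<longlongrightarrow> \<Lambda> s2 - \<Lambda> s1 + (s1 - s2) * b) F"
      by (intro tendsto_intros Klim inU c)
    moreover have "\<Lambda> s2 - \<Lambda> s1 + (s1 - s2) * b < - \<kappa>"
      using subgrad[of s1 s2] inU \<kappa>(3) by (simp add: algebra_simps)
    ultimately have e2: "\<forall>\<^sub>F i in F. K s2 i / a i - K s1 i / a i + (s1 - s2) * b < - \<kappa>"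
      by (rule order_tendstoD)
    \<comment> \<open>Beyond this size each discarded piece is at most a quarter of
      \<open>exp (K s1 i)\<close>. Half of it survives, which is the \<open>ln 2\<close>
      below.\<close>
    have e3: "\<forall>\<^sub>F i in F. a i > ln 4 / \<kappa>"
      using a by (auto simp: filterlim_at_top_dense)
    have "((\<lambda>i. K s1 i / a i - s1 * b - ln 2 / a i) \<longlongrightarrow> \<Lambda> s1 - s1 * b - 0) F"
      by (intro tendsto_intros Klim inU tendsto_divide_0[OF tendsto_const]
          filterlim_at_top_imp_at_infinity a)
    then have e4: "\<forall>\<^sub>F i in F. K s1 i / a i - s1 * b - ln 2 / a i > l"
      using main by (intro order_tendstoD) auto
    show ?thesis
      using e1 e2 e3 e4 apos p(1) K[OF inU(1)] K[OF inU(2)] K[OF inU(3)]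
        int[OF inU(1)] int[OF inU(2)] int[OF inU(3)] rv
    proof eventually_elim
      case (elim i)
      have x1: "exp ((s1 * a i - s0 * a i) * c i) * exp (K s0 i) \<le> exp (K s1 i) / 4"
      proof -
        have "(K s0 i / a i - K s1 i / a i + (s1 - s0) * c i) * a i < - \<kappa> * a i"
          using elim(1) \<open>a i > 0\<close> by (intro mult_strict_right_mono) auto
        also have "(K s0 i / a i - K s1 i / a i + (s1 - s0) * c i) * a i
            = K s0 i - K s1 i + (s1 - s0) * c i * a i"
          using \<open>a i > 0\<close> by (simp add: field_simps)
        finally have "K s0 i - K s1 i + (s1 - s0) * c i * a i < - \<kappa> * a i" .
        also have "- \<kappa> * a i \<le> - ln 4"
          using elim(3) \<kappa>(1) \<open>a i > 0\<close> by (simp add: field_simps)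
        finally have "(s1 * a i - s0 * a i) * c i + K s0 i \<le> K s1 i - ln 4"
          by (simp add: algebra_simps)
        then have "exp ((s1 * a i - s0 * a i) * c i + K s0 i) \<le> exp (K s1 i - ln 4)"
          by simp
        then show ?thesis
          by (simp add: exp_add exp_diff)
      qed
      have x2: "exp ((s1 * a i - s2 * a i) * b) * exp (K s2 i) \<le> exp (K s1 i) / 4"
      proof -
        have "(K s2 i / a i - K s1 i / a i + (s1 - s2) * b) * a i < - \<kappa> * a i"
          using elim(2) \<open>a i > 0\<close> by (intro mult_strict_right_mono) auto
        also have "(K s2 i / a i - K s1 i / a i + (s1 - s2) * b) * a i
            = K s2 i - K s1 i + (s1 - s2) * b * a i"
          using \<open>a i > 0\<close> by (simp add: field_simps)
        finally have "K s2 i - K s1 i + (s1 - s2) * b * a i < - \<kappa> * a i" .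
        also have "- \<kappa> * a i \<le> - ln 4"
          using elim(3) \<kappa>(1) \<open>a i > 0\<close> by (simp add: field_simps)
        finally have "(s1 * a i - s2 * a i) * b + K s2 i \<le> K s1 i - ln 4"
          by (simp add: algebra_simps)
        then have "exp ((s1 * a i - s2 * a i) * b + K s2 i) \<le> exp (K s1 i - ln 4)"
          by simp
        then show ?thesis
          by (simp add: exp_add exp_diff)
      qed
      have "exp (- (s1 * a i) * b + K s1 i - ln 2) = exp (- (s1 * a i) * b) * (exp (K s1 i) / 2)"
        by (simp only: exp_diff exp_add exp_ln zero_less_numeral times_divide_eq_right)
      also have "\<dots> \<le> exp (- (s1 * a i) * b) * (exp (K s1 i)
          - exp ((s1 * a i - s0 * a i) * c i) * exp (K s0 i) - exp ((s1 * a i - s2 * a i) * b) * exp (K s2 i))"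
        by (rule mult_left_mono[OF _ exp_ge_zero]) (use x1 x2 in linarith)
      also have "\<dots> \<le> prob {\<omega> \<in> space M. Y i \<omega> > c i}"
        using prob_greater_ge_exponential_moments[OF \<open>random_variable borel (Y i)\<close>, of "s0 * a i" "s1 * a i" "s2 * a i" b "c i"]
          elim ord by (simp add: mult_right_mono)
      also note \<open>\<dots> \<le> p i\<close>
      finally have le: "exp (- (s1 * a i) * b + K s1 i - ln 2) \<le> p i" .
      have ppos: "p i > 0"
        using le exp_gt_zero[of "- (s1 * a i) * b + K s1 i - ln 2"] by linarith
      have "- (s1 * a i) * b + K s1 i - ln 2 \<le> ln (p i)"
        using le ppos by (simp add: ln_ge_iff)
      then have "(- (s1 * a i) * b + K s1 i - ln 2) / a i \<le> ln (p i) / a i"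
        using \<open>a i > 0\<close> by (intro divide_right_mono) auto
      moreover have "(- (s1 * a i) * b + K s1 i - ln 2) / a i = K s1 i / a i - s1 * b - ln 2 / a i"
        using \<open>a i > 0\<close> by (simp add: field_simps)
      ultimately show ?case
        using elim(4) ppos by linarith
    qed
  qed
  have ppos: "\<forall>\<^sub>F i in F. p i > 0"
    using low[of "\<Lambda> s - s * \<Phi> s - 1"] by (auto elim: eventually_mono)
  show ?thesis
  proof (rule order_tendstoI)
    fix u assume u: "\<Lambda> s - s * \<Phi> s < u"
    have "((\<lambda>i. K s i / a i - s * c i) \<longlongrightarrow> \<Lambda> s - s * \<Phi> s) F"
      by (intro tendsto_intros Klim U c)
    then have "\<forall>\<^sub>F i in F. K s i / a i - s * c i < u"
      using u by (rule order_tendstoD)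
    then show "\<forall>\<^sub>F i in F. ln (p i) / a i < u"
      using p(2) K[OF U(2)] int[OF U(2)] apos ppos
    proof eventually_elim
      case (elim i)
      have "p i \<le> exp (- (s * a i) * c i) * exp (K s i)"
      \<comment> \<open>The Chernoff inequality requires a positive exponent; at
        \<open>s = 0\<close> the trivial bound by 1 is already the claim.\<close>
      proof (cases "s = 0")
        case True
        have "p i \<le> 1"
          using elim(2) prob_le_1 order_trans by blast
        moreover have "K s i = 0" using True by (simp add: K_def prob_space)
        ultimately show ?thesis using True by simp
      next
        case False
        then have "s * a i > 0" using \<open>s \<ge> 0\<close> elim by simp
        have "p i \<le> exp (- (s * a i) * c i) * expectation (\<lambda>\<omega>. exp (s * a i * Y i \<omega>))"
          using Chernoff_ineq_ge[OF \<open>s * a i > 0\<close>, of "space M" "Y i" "c i"] elim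
          by (auto simp: set_integrable_def set_lebesgue_integral_def indicator_def
              cong: Bochner_Integration.integrable_cong Bochner_Integration.integral_cong)
        then show ?thesis using elim by simp
      qed
      then have "p i \<le> exp (K s i - s * a i * c i)"
        by (simp add: exp_diff exp_minus divide_inverse mult.commute)
      then have "ln (p i) \<le> K s i - s * a i * c i"
        using \<open>p i > 0\<close> by (metis ln_exp ln_le_cancel_iff exp_gt_zero)
      then have "ln (p i) / a i \<le> (K s i - s * a i * c i) / a i"
        using \<open>a i > 0\<close> by (intro divide_right_mono) auto
      also have "\<dots> = K s i / a i - s * c i"
        using \<open>a i > 0\<close> by (simp add: field_simps)
      finally show ?case using elim(1) by simp
    qed
  next
    fix l assume "l < \<Lambda> s - s * \<Phi> s"
    from low[OF this] show "\<forall>\<^sub>F i in F. l < ln (p i) / a i"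
      by (rule eventually_mono) simp
  qed
qed

section \<open>Series of independent exponential variables\<close>

text \<open>Linearity in \<open>u\<close> lets sums and integrals of logarithms be dominated by
  those of their arguments. The minimum covers both signs of \<open>s\<close>:
  \<open>1 - s * u\<close> never drops below it, and \<open>ln z \<le> z - 1\<close> is used at
  \<open>z\<close> and at \<open>1 / z\<close>.\<close>

lemma ln_one_minus_mult_bound:
  fixes s u u0 :: real
  assumes "0 \<le> u" "u \<le> u0" "s * u0 < 1"
  shows "\<bar>ln (1 - s * u)\<bar> \<le> (\<bar>s\<bar> / min 1 (1 - s * u0)) * u"
proof -
  define m where "m = min 1 (1 - s * u0)"
  have m: "0 < m" "m \<le> 1"
    using assms by (auto simp: m_def)
  have ge: "1 - s * u \<ge> m"
  proof (cases "s \<ge> 0")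
    case True
    then have "s * u \<le> s * u0" using assms by (intro mult_left_mono) auto
    then show ?thesis by (simp add: m_def)
  next
    case False
    then have "s * u \<le> 0" using assms by (simp add: mult_nonpos_nonneg)
    then show ?thesis by (simp add: m_def)
  qed
  then have pos: "1 - s * u > 0" using m by linarith
  have "\<bar>s * u\<bar> \<le> \<bar>s * u\<bar> / m"
    using m by (simp add: field_simps mult_left_le_one_le)
  have "ln (1 - s * u) \<le> - (s * u)"
    using ln_le_minus_one[OF pos] by simp
  then have up: "ln (1 - s * u) \<le> \<bar>s * u\<bar> / m"
    using \<open>\<bar>s * u\<bar> \<le> \<bar>s * u\<bar> / m\<close> by linarith
  have "- ln (1 - s * u) = ln (1 / (1 - s * u))"
    using pos by (simp add: ln_div)
  also have "\<dots> \<le> 1 / (1 - s * u) - 1"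
    using pos by (intro ln_le_minus_one) auto
  also have "\<dots> = (s * u) / (1 - s * u)"
    using pos by (simp add: field_simps)
  also have "\<dots> \<le> \<bar>s * u\<bar> / m"
    using ge m by (intro frac_le) auto
  finally have "\<bar>ln (1 - s * u)\<bar> \<le> \<bar>s * u\<bar> / m"
    using up by linarith
  then show ?thesis
    using assms by (simp add: m_def abs_mult)
qed

text \<open>Exponential densities are closed under tilting: the factor
  \<open>exp (\<theta> * x)\<close> turns the rate \<open>l\<close> into \<open>l - \<theta>\<close>
  up to the constant \<open>l / (l - \<theta>)\<close>, so normalisation of the new density gives
  integrability and value together.\<close>

lemma (in prob_space) exponential_moment_generating:
  assumes D: "distributed M lborel X (exponential_density l)" and "l > 0" and "\<theta> < l"
  shows "integrable M (\<lambda>\<omega>. exp (\<theta> * X \<omega>))"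
    and "expectation (\<lambda>\<omega>. exp (\<theta> * X \<omega>)) = 1 / (1 - \<theta> / l)"
proof -
  have tilt: "exponential_density l x * exp (\<theta> * x) = l / (l - \<theta>) * exponential_density (l - \<theta>) x" for x
  proof -
    have "exp (- x * l) * exp (\<theta> * x) = exp (- x * (l - \<theta>))"
      by (simp add: algebra_simps flip: exp_add)
    then show ?thesis
      using \<open>\<theta> < l\<close> by (simp add: exponential_density_def)
  qed
  have one: "has_bochner_integral lborel (exponential_density (l - \<theta>)) 1"
  proof -
    interpret P: prob_space "density lborel (exponential_density (l - \<theta>))"
      using \<open>\<theta> < l\<close> by (intro prob_space_exponential_density) simp
    have "emeasure (density lborel (exponential_density (l - \<theta>))) UNIV = 1"
      using P.emeasure_space_1 by simp
    then have "(\<integral>\<^sup>+x. ennreal (exponential_density (l - \<theta>) x) \<partial>lborel) = ennreal 1"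
      by (simp add: emeasure_density)
    then show ?thesis
      using \<open>\<theta> < l\<close> by (intro has_bochner_integral_nn_integral)
        (auto simp: exponential_density_def)
  qed
  have nonneg: "AE x in lborel. exponential_density l x \<ge> 0"
    using \<open>l > 0\<close> by (auto simp: exponential_density_def)
  have "integrable lborel (\<lambda>x. exponential_density l x * exp (\<theta> * x))"
    unfolding tilt using one by (auto simp: has_bochner_integral_iff)
  then show "integrable M (\<lambda>\<omega>. exp (\<theta> * X \<omega>))"
    using distributed_integrable[OF D, of "\<lambda>x. exp (\<theta> * x)"] \<open>l > 0\<close>
    by (simp add: exponential_density_nonneg)
  have "expectation (\<lambda>\<omega>. exp (\<theta> * X \<omega>)) = (\<integral>x. exponential_density l x * exp (\<theta> * x) \<partial>lborel)"
    using distributed_integral[OF D, of "\<lambda>x. exp (\<theta> * x)"] \<open>l > 0\<close>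
    by (simp add: exponential_density_nonneg)
  also have "\<dots> = l / (l - \<theta>)"
    unfolding tilt using one by (simp add: has_bochner_integral_iff)
  also have "\<dots> = 1 / (1 - \<theta> / l)"
    using \<open>l > 0\<close> \<open>\<theta> < l\<close> by (simp add: field_simps)
  finally show "expectation (\<lambda>\<omega>. exp (\<theta> * X \<omega>)) = 1 / (1 - \<theta> / l)" .
qed

lemma (in prob_space) exponential_AE_pos:
  assumes D: "distributed M lborel X (exponential_density l)"
  shows "AE \<omega> in M. X \<omega> > 0"
proof -
  have "AE x in density lborel (exponential_density l). x > 0"
  proof (subst AE_density)
    show "AE x in lborel. 0 < ennreal (exponential_density l x) \<longrightarrow> 0 < x"
      \<comment> \<open>The density vanishes on the negative axis but need not at 0, so this one
        point is discarded as a null set.\<close>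
      using AE_lborel_singleton[of "0::real"]
      by eventually_elim (auto simp: exponential_density_def not_less ennreal_eq_0_iff)
  qed auto
  then have "AE x in distr M lborel X. x > 0"
    by (simp only: distributed_distr_eq_density[OF D])
  then show ?thesis
    using distributed_measurable[OF D] by (subst (asm) AE_distr_iff) auto
qed

text \<open>Indexing from 0 over all naturals makes every tail of the holding times an instance,
  shifted to start at state \<open>n + 1\<close>.\<close>

locale exponential_series = prob_space +
  fixes X :: "nat \<Rightarrow> 'a \<Rightarrow> real" and l :: "nat \<Rightarrow> real"
  assumes indep: "indep_vars (\<lambda>_. borel) X UNIV"
    and distributed: "\<And>k. distributed M lborel (X k) (exponential_density (l k))"
    and rate_pos: "\<And>k. l k > 0"
    and summable_means: "summable (\<lambda>k. 1 / l k)"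
begin

lemma measurable_X [measurable]: "random_variable borel (X k)"
  using distributed_measurable[OF distributed] by simp

lemma AE_X_pos: "AE \<omega> in M. \<forall>k. X k \<omega> > 0"
  using exponential_AE_pos[OF distributed] by (simp add: AE_all_countable)

lemma expectation_X: "expectation (X k) = 1 / l k"
  using exponential_distributed_expectation[OF rate_pos distributed] by simp

text \<open>The Bochner integral of a non-integrable function is 0 by default, so an expectation
  known to be nonzero forces integrability.\<close>

lemma integrable_X: "integrable M (X k)"
proof (rule ccontr)
  assume "\<not> integrable M (X k)"
  then have "expectation (X k) = 0" by (rule not_integrable_integral_eq)
  then show False using expectation_X[of k] rate_pos[of k] by simp
qed

lemma nn_integral_X: "(\<integral>\<^sup>+\<omega>. ennreal (X k \<omega>) \<partial>M) = ennreal (1 / l k)"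
proof -
  have "AE \<omega> in M. X k \<omega> \<ge> 0"
    using AE_X_pos by eventually_elim (simp add: less_imp_le)
  then show ?thesis
    using nn_integral_eq_integral[OF integrable_X[of k]] by (simp add: expectation_X)
qed

text \<open>By Tonelli the series has finite expectation in the extended nonnegative reals, hence is
  finite almost surely.\<close>

lemma AE_summable: "AE \<omega> in M. summable (\<lambda>k. X k \<omega>)"
proof -
  have "(\<integral>\<^sup>+\<omega>. (\<Sum>k. ennreal (X k \<omega>)) \<partial>M) = (\<Sum>k. ennreal (1 / l k))"
    by (subst nn_integral_suminf) (auto simp: nn_integral_X)
  also have "\<dots> < \<infinity>"
    using summable_means rate_pos by (simp add: suminf_ennreal2 less_imp_le)
  finally have "AE \<omega> in M. (\<Sum>k. ennreal (X k \<omega>)) \<noteq> \<infinity>"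
    by (intro nn_integral_PInf_AE) auto
  then show ?thesis
    using AE_X_pos
    by eventually_elim (auto intro!: summable_suminf_not_top simp: less_imp_le)
qed

lemma expectation_series:
  "expectation (\<lambda>\<omega>. \<Sum>k. X k \<omega>) = (\<Sum>k. 1 / l k)"
proof -
  have norm: "AE \<omega> in M. norm (X k \<omega>) = X k \<omega>" for k
    using AE_X_pos by eventually_elim (simp add: less_imp_le)
  have *: "AE \<omega> in M. summable (\<lambda>k. norm (X k \<omega>))"
    using AE_summable AE_X_pos by eventually_elim (simp add: less_imp_le)
  have "expectation (\<lambda>\<omega>. norm (X k \<omega>)) = 1 / l k" for k
    using norm by (subst integral_cong_AE[OF _ _ norm]) (auto simp: expectation_X)
  then have **: "summable (\<lambda>k. expectation (\<lambda>\<omega>. norm (X k \<omega>)))"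
    using summable_means by simp
  show "expectation (\<lambda>\<omega>. \<Sum>k. X k \<omega>) = (\<Sum>k. 1 / l k)"
    using integral_suminf[OF integrable_X * **] by (simp add: expectation_X)
qed

lemma exponential_moment_partial_sum:
  assumes \<theta>: "\<And>k. \<theta> < l k"
  shows "integrable M (\<lambda>\<omega>. exp (\<theta> * (\<Sum>k<N. X k \<omega>)))"
    and "expectation (\<lambda>\<omega>. exp (\<theta> * (\<Sum>k<N. X k \<omega>))) = (\<Prod>k<N. 1 / (1 - \<theta> / l k))"
proof -
  have I: "indep_vars (\<lambda>_. borel) (\<lambda>k \<omega>. exp (\<theta> * X k \<omega>)) {..<N}"
    by (rule indep_vars_compose2[OF indep_vars_subset[OF indep]]) auto
  note single = exponential_moment_generating[OF distributed rate_pos \<theta>]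
  have eq: "exp (\<theta> * (\<Sum>k<N. X k \<omega>)) = (\<Prod>k<N. exp (\<theta> * X k \<omega>))" for \<omega>
    by (simp add: sum_distrib_left exp_sum)
  show "integrable M (\<lambda>\<omega>. exp (\<theta> * (\<Sum>k<N. X k \<omega>)))"
    unfolding eq by (rule indep_vars_integrable[OF _ I]) (auto intro: single)
  show "expectation (\<lambda>\<omega>. exp (\<theta> * (\<Sum>k<N. X k \<omega>))) = (\<Prod>k<N. 1 / (1 - \<theta> / l k))"
    unfolding eq by (subst indep_vars_lebesgue_integral[OF _ I]) (auto simp: single)
qed

text \<open>Independence gives the product formula for partial sums, and monotone convergence
  carries integrability and value to the limit. Summability of the logarithms is the convergence of
  the infinite product.\<close>

lemma exponential_moment_series:
  assumes \<theta>: "\<And>k. \<theta> < l k" and sl: "summable (\<lambda>k. - ln (1 - \<theta> / l k))"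
  shows "integrable M (\<lambda>\<omega>. exp (\<theta> * (\<Sum>k. X k \<omega>)))"
    and "expectation (\<lambda>\<omega>. exp (\<theta> * (\<Sum>k. X k \<omega>))) = exp (\<Sum>k. - ln (1 - \<theta> / l k))"
proof -
  \<comment> \<open>The sign makes the partial exponential moments increase also when \<open>\<theta> < 0\<close>.\<close>
  define \<sigma> :: real where "\<sigma> = (if \<theta> \<ge> 0 then 1 else - 1)"
  have \<sigma>: "\<sigma> * \<sigma> = 1" by (simp add: \<sigma>_def)
  define f where "f N \<omega> = \<sigma> * exp (\<theta> * (\<Sum>k<N. X k \<omega>))" for N \<omega>
  define S where "S = exp (\<Sum>k. - ln (1 - \<theta> / l k))"
  have pos: "1 - \<theta> / l k > 0" for k
    using \<theta>[of k] rate_pos[of k] by (simp add: field_simps)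
  have ex: "expectation (\<lambda>\<omega>. exp (\<theta> * (\<Sum>k<N. X k \<omega>))) = exp (\<Sum>k<N. - ln (1 - \<theta> / l k))" for N
    unfolding exponential_moment_partial_sum[OF \<theta>]
    using pos by (simp add: exp_sum exp_minus inverse_eq_divide)
  have ints: "integrable M (f N)" for N
    unfolding f_def by (intro integrable_mult_right exponential_moment_partial_sum \<theta>)
  have mono: "AE \<omega> in M. mono (\<lambda>N. f N \<omega>)"
    using AE_X_pos
  proof eventually_elim
    case (elim \<omega>)
    show ?case
    proof (rule incseq_SucI)
      fix N
      show "f N \<omega> \<le> f (Suc N) \<omega>"
      proof (cases "\<theta> \<ge> 0")
        case True
        then show ?thesis
          using elim[rule_format, of N] by (simp add: f_def \<sigma>_def distrib_left)
      next
        case False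
        then have "\<theta> * X N \<omega> \<le> 0"
          using elim[rule_format, of N] by (simp add: mult_nonpos_nonneg)
        then show ?thesis
          using False by (simp add: f_def \<sigma>_def distrib_left)
      qed
    qed
  qed
  have lim: "AE \<omega> in M. (\<lambda>N. f N \<omega>) \<longlonglongrightarrow> \<sigma> * exp (\<theta> * (\<Sum>k. X k \<omega>))"
    using AE_summable unfolding f_def
    by eventually_elim (intro tendsto_intros summable_LIMSEQ)
  have "(\<lambda>N. \<sigma> * exp (\<Sum>k<N. - ln (1 - \<theta> / l k))) \<longlonglongrightarrow> \<sigma> * S"
    unfolding S_def by (intro tendsto_intros summable_LIMSEQ sl)
  then have intlim: "(\<lambda>N. expectation (f N)) \<longlonglongrightarrow> \<sigma> * S"
    unfolding f_def by (simp only: integral_mult_right_zero ex)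
  have meas: "(\<lambda>\<omega>. \<sigma> * exp (\<theta> * (\<Sum>k. X k \<omega>))) \<in> borel_measurable M"
    by measurable
  have "integrable M (\<lambda>\<omega>. \<sigma> * exp (\<theta> * (\<Sum>k. X k \<omega>)))"
    by (rule integrable_monotone_convergence[OF ints mono lim intlim meas])
  then have "integrable M (\<lambda>\<omega>. \<sigma> * (\<sigma> * exp (\<theta> * (\<Sum>k. X k \<omega>))))"
    by (rule integrable_mult_right)
  then show "integrable M (\<lambda>\<omega>. exp (\<theta> * (\<Sum>k. X k \<omega>)))"
    by (simp add: \<sigma> flip: mult.assoc)
  have "expectation (\<lambda>\<omega>. \<sigma> * exp (\<theta> * (\<Sum>k. X k \<omega>))) = \<sigma> * S"
    by (rule integral_monotone_convergence[OF ints mono lim intlim meas])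
  then have "\<sigma> * expectation (\<lambda>\<omega>. exp (\<theta> * (\<Sum>k. X k \<omega>))) = \<sigma> * S"
    by simp
  then show "expectation (\<lambda>\<omega>. exp (\<theta> * (\<Sum>k. X k \<omega>))) = exp (\<Sum>k. - ln (1 - \<theta> / l k))"
    unfolding S_def by (simp add: \<sigma>_def split: if_splits)
qed

end

section \<open>Riemann sums for regularly varying rates\<close>

lemma powr_integrable_atLeast_one:
  assumes "p > 1"
  shows "set_integrable lborel {1..} (\<lambda>y::real. y powr - p)"
    and "(LINT y:{1..}|lborel. y powr - p) = 1 / (p - 1)"
proof -
  have hi: "((\<lambda>y. y powr - p) has_integral 1 / (p - 1)) {1..}"
    using has_integral_powr_to_inf[of "- p" 1] assms by (simp add: minus_divide_right)
  then have "set_integrable lebesgue {1..} (\<lambda>y::real. y powr - p)"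
    by (intro nonnegative_absolutely_integrable_1) auto
  then show *: "set_integrable lborel {1..} (\<lambda>y::real. y powr - p)"
    unfolding set_integrable_def by (subst (asm) integrable_completion) auto
  show "(LINT y:{1..}|lborel. y powr - p) = 1 / (p - 1)"
    using set_borel_integral_eq_integral(2)[OF *] integral_unique[OF hi] by simp
qed

text \<open>Reads a sum divided by \<open>n\<close> as the integral of a step function with cells of
  width \<open>1 / n\<close>, so that convergence of Riemann sums on an unbounded interval becomes a
  matter of dominated convergence.\<close>

lemma integral_staircase:
  fixes a :: "nat \<Rightarrow> real"
  assumes "n > 0" and sm: "summable (\<lambda>k. \<bar>a k\<bar>)"
  shows "integral\<^sup>L lborel (\<lambda>y. if y \<ge> 1 then a (nat \<lfloor>real n * y\<rfloor> - n) else 0) = (\<Sum>k. a k) / real n"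
    and "integrable lborel (\<lambda>y. if y \<ge> 1 then a (nat \<lfloor>real n * y\<rfloor> - n) else 0)"
proof -
  define I :: "nat \<Rightarrow> real set" where "I k = {real (n + k) / real n ..< real (n + k + 1) / real n}" for k
  \<comment> \<open>Cell \<open>k\<close> starts at \<open>1 + k / n\<close>, so its index is the
    integer part of \<open>n * y\<close> minus \<open>n\<close>. The truncated subtraction also
    returns 0 to the left of 1, which is why \<open>y \<ge> 1\<close> stays in the
    equivalence.\<close>
  have in_I: "y \<in> I k \<longleftrightarrow> y \<ge> 1 \<and> k = nat \<lfloor>real n * y\<rfloor> - n" for y k
  proof -
    have "y \<in> I k \<longleftrightarrow> real (n + k) \<le> real n * y \<and> real n * y < real (n + k + 1)"
      using \<open>n > 0\<close> by (simp add: I_def pos_divide_le_eq pos_less_divide_eq mult.commute)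
    also have "\<dots> \<longleftrightarrow> \<lfloor>real n * y\<rfloor> = int (n + k)"
      by (simp add: floor_eq_iff add_ac)
    also have "\<dots> \<longleftrightarrow> \<lfloor>real n * y\<rfloor> \<ge> int n \<and> k = nat \<lfloor>real n * y\<rfloor> - n"
      by linarith
    also have "\<lfloor>real n * y\<rfloor> \<ge> int n \<longleftrightarrow> y \<ge> 1"
      using \<open>n > 0\<close> by (simp add: le_floor_iff)
    finally show ?thesis .
  qed
  let ?f = "\<lambda>y. if y \<ge> 1 then a (nat \<lfloor>real n * y\<rfloor> - n) else 0"
  define q where "q k y = indicator (I k) y * a k" for k y
  have sums: "(\<lambda>k. q k y) sums (if y \<ge> 1 then a (nat \<lfloor>real n * y\<rfloor> - n) else 0)" for y
  proof (cases "y \<ge> 1")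
    case True
    have "(\<lambda>k. q k y) = (\<lambda>k. if k = nat \<lfloor>real n * y\<rfloor> - n then a k else 0)"
      using True by (auto simp: q_def in_I indicator_def fun_eq_iff)
    then show ?thesis
      using sums_single[of "nat \<lfloor>real n * y\<rfloor> - n" a] True by simp
  next
    case False
    then show ?thesis by (simp add: q_def in_I indicator_def)
  qed
  have suminf_q: "(\<lambda>y. \<Sum>k. q k y) = ?f"
    using sums by (intro ext) (rule sums_unique[symmetric])
  have norm_summable: "summable (\<lambda>k. norm (q k y))" for y
    by (rule summable_finite[of "{nat \<lfloor>real n * y\<rfloor> - n}"]) (auto simp: q_def in_I indicator_def)
  have len: "measure lborel (I k) = 1 / real n" for k
    using \<open>n > 0\<close> by (simp add: I_def divide_right_mono flip: diff_divide_distrib)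
  have I_sets: "I k \<in> sets lborel" "emeasure lborel (I k) < \<infinity>" for k
    unfolding I_def using \<open>n > 0\<close> by (auto simp: divide_right_mono)
  have int_q: "integrable lborel (q k)" for k
    unfolding q_def using I_sets by (intro integrable_mult_left integrable_real_indicator)
  have val_q: "integral\<^sup>L lborel (q k) = a k / real n" for k
    unfolding q_def by (simp add: len)
  have "norm (q k y) = indicator (I k) y * \<bar>a k\<bar>" for k y
    by (simp add: q_def abs_mult)
  then have val_norm: "integral\<^sup>L lborel (\<lambda>y. norm (q k y)) = \<bar>a k\<bar> / real n" for k
    by (simp add: len)
  have sm': "summable (\<lambda>k. integral\<^sup>L lborel (\<lambda>y. norm (q k y)))"
    unfolding val_norm by (intro summable_divide sm)
  have "integral\<^sup>L lborel (\<lambda>y. \<Sum>k. q k y) = (\<Sum>k. a k / real n)"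
    using integral_suminf[OF int_q _ sm'] norm_summable by (simp add: val_q)
  also have "\<dots> = (\<Sum>k. a k) / real n"
    by (rule suminf_divide[OF summable_rabs_cancel[OF sm]])
  finally show "integral\<^sup>L lborel (\<lambda>y. if y \<ge> 1 then a (nat \<lfloor>real n * y\<rfloor> - n) else 0) = (\<Sum>k. a k) / real n"
    unfolding suminf_q .
  have "integrable lborel (\<lambda>y. \<Sum>k. q k y)"
    using integrable_suminf[OF int_q _ sm'] norm_summable by simp
  then show "integrable lborel (\<lambda>y. if y \<ge> 1 then a (nat \<lfloor>real n * y\<rfloor> - n) else 0)"
    unfolding suminf_q .
qed

locale regularly_varying_rates =
  fixes \<beta> :: real and L :: "real \<Rightarrow> real"
  assumes beta: "\<beta> > 1" and slow: "slowly_varying L"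
begin

definition rate :: "nat \<Rightarrow> real" where
  "rate n = real n powr \<beta> * L (real n)"

lemma L_pos: "x \<ge> 1 \<Longrightarrow> L x > 0"
  using slow by (simp add: slowly_varying_def)

lemma rate_pos: "n \<ge> 1 \<Longrightarrow> rate n > 0"
  using L_pos[of "real n"] by (simp add: rate_def)

text \<open>The Potter bound costs \<open>\<delta>\<close> in the exponent and
  \<open>exp \<delta>\<close> in front. Both losses are affordable for small
  \<open>\<delta>\<close>: the exponent \<open>\<beta> - \<delta>\<close> stays above 1, which gives
  integrability, and the factor stays close to 1.\<close>

lemma rate_ratio_bound:
  assumes "\<delta> > 0"
  obtains N where "N \<ge> 1" "\<And>n m. N \<le> n \<Longrightarrow> n \<le> m \<Longrightarrow>
    rate n / rate m \<le> exp \<delta> * (real m / real n) powr - (\<beta> - \<delta>)"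
proof -
  obtain X0 where X0: "X0 \<ge> 1" and Potter:
    "\<And>x y. x \<ge> X0 \<Longrightarrow> x \<le> y \<Longrightarrow> \<bar>ln (L y) - ln (L x)\<bar> \<le> \<delta> * (1 + ln (y / x))"
    using slowly_varying_Potter[OF slow assms] by blast
  show ?thesis
  proof (rule that[of "nat \<lceil>X0\<rceil>"])
    fix n m assume n: "nat \<lceil>X0\<rceil> \<le> n" and "n \<le> m"
    have n0: "real n \<ge> X0" "real n \<ge> 1" "real m \<ge> 1" "real n \<le> real m"
      using n X0 \<open>n \<le> m\<close> by linarith+
    define z where "z = real m / real n"
    have z: "z > 0" using n0 by (simp add: z_def)
    have "ln (L n / L m) \<le> \<delta> * (1 + ln z)"
      using Potter[OF n0(1,4)] L_pos[OF n0(2)] L_pos[OF n0(3)] by (simp add: ln_div z_def)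
    then have "exp (ln (L n / L m)) \<le> exp (\<delta> * (1 + ln z))"
      by simp
    then have *: "L n / L m \<le> exp \<delta> * z powr \<delta>"
      using L_pos[OF n0(2)] L_pos[OF n0(3)] z by (simp add: powr_def exp_add distrib_left)
    have "z powr - \<beta> = real n powr \<beta> / real m powr \<beta>"
      by (simp add: z_def powr_minus powr_divide)
    then have "rate n / rate m = (L n / L m) * z powr - \<beta>"
      by (simp add: rate_def mult.commute)
    also have "\<dots> \<le> (exp \<delta> * z powr \<delta>) * z powr - \<beta>"
      by (intro mult_right_mono * powr_ge_zero)
    also have "\<dots> = exp \<delta> * z powr - (\<beta> - \<delta>)"
      by (simp add: algebra_simps powr_diff powr_minus divide_inverse)
    finally show "rate n / rate m \<le> exp \<delta> * (real m / real n) powr - (\<beta> - \<delta>)"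
      by (simp add: z_def)
  qed (use X0 in linarith)
qed

text \<open>The definition of slow variation controls fixed factors only. With both indices moving,
  the Potter bound with arbitrarily small \<open>\<delta>\<close> makes the ratio of the values of
  \<open>L\<close> tend to 1, as the logarithm of \<open>i t / j t\<close> stays bounded.\<close>

lemma rate_ratio_tendsto:
  fixes i j :: "'i \<Rightarrow> nat"
  assumes i: "filterlim i at_top F" and j: "filterlim j at_top F"
    and ratio: "((\<lambda>t. real (i t) / real (j t)) \<longlongrightarrow> x) F" and "x > 0"
  shows "((\<lambda>t. rate (i t) / rate (j t)) \<longlongrightarrow> x powr \<beta>) F"
proof -
  have "((\<lambda>t. ln (real (i t) / real (j t))) \<longlongrightarrow> ln x) F"
    using tendsto_ln[OF ratio] \<open>x > 0\<close> by simp
  from tendsto_rabs[OF this]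
  have bounded: "\<forall>\<^sub>F t in F. \<bar>ln (real (i t) / real (j t))\<bar> < \<bar>ln x\<bar> + 1"
    by (rule order_tendstoD) simp
  have "((\<lambda>t. ln (L (real (i t))) - ln (L (real (j t)))) \<longlongrightarrow> 0) F"
  proof (rule tendstoI)
    fix e :: real assume "e > 0"
    \<comment> \<open>Chosen so that \<open>\<delta> * (1 + \<bar>ln (i t / j t)\<bar>)\<close>
      falls below \<open>e\<close> as soon as
      \<open>\<bar>ln (i t / j t)\<bar> < \<bar>ln x\<bar> + 1\<close>.\<close>
    define \<delta> where "\<delta> = e / (\<bar>ln x\<bar> + 2)"
    have \<delta>: "\<delta> > 0" "\<delta> * (\<bar>ln x\<bar> + 2) = e"
      using \<open>e > 0\<close> by (auto simp: \<delta>_def add_nonneg_pos)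
    obtain X0 where X0: "X0 \<ge> 1" and Potter:
      "\<And>x y. x \<ge> X0 \<Longrightarrow> x \<le> y \<Longrightarrow> \<bar>ln (L y) - ln (L x)\<bar> \<le> \<delta> * (1 + ln (y / x))"
      using slowly_varying_Potter[OF slow \<delta>(1)] by blast
    have "\<forall>\<^sub>F t in F. i t \<ge> nat \<lceil>X0\<rceil>" "\<forall>\<^sub>F t in F. j t \<ge> nat \<lceil>X0\<rceil>"
      using i j by (simp_all only: filterlim_at_top)
    with bounded show "\<forall>\<^sub>F t in F. dist (ln (L (real (i t))) - ln (L (real (j t)))) 0 < e"
    proof eventually_elim
      case (elim t)
      then have ge: "real (i t) \<ge> X0" "real (j t) \<ge> X0"
        by linarith+
      have flip: "ln (real (j t) / real (i t)) = - ln (real (i t) / real (j t))"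
        using ge X0 by (simp add: ln_div)
      have "\<bar>ln (L (real (i t))) - ln (L (real (j t)))\<bar> \<le> \<delta> * (1 + \<bar>ln (real (i t) / real (j t))\<bar>)"
      proof (cases "real (i t) \<le> real (j t)")
        case True
        have "\<bar>ln (L (real (j t))) - ln (L (real (i t)))\<bar> \<le> \<delta> * (1 + ln (real (j t) / real (i t)))"
          by (rule Potter[OF ge(1) True])
        also have "\<dots> \<le> \<delta> * (1 + \<bar>ln (real (i t) / real (j t))\<bar>)"
          unfolding flip using \<delta>(1) by (intro mult_left_mono) auto
        finally show ?thesis by (simp add: abs_minus_commute)
      next
        case False
        have "\<bar>ln (L (real (i t))) - ln (L (real (j t)))\<bar> \<le> \<delta> * (1 + ln (real (i t) / real (j t)))"
          by (rule Potter[OF ge(2)]) (use False in auto)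
        also have "\<dots> \<le> \<delta> * (1 + \<bar>ln (real (i t) / real (j t))\<bar>)"
          using \<delta>(1) by (intro mult_left_mono) auto
        finally show ?thesis .
      qed
      also have "\<dots> < \<delta> * (\<bar>ln x\<bar> + 2)"
        using \<delta>(1) elim(1) by (intro mult_strict_left_mono) auto
      finally show ?case using \<delta>(2) by (simp add: dist_real_def)
    qed
  qed
  then have "((\<lambda>t. exp (ln (L (real (i t))) - ln (L (real (j t))))) \<longlongrightarrow> exp 0) F"
    by (rule tendsto_exp)
  then have "((\<lambda>t. (real (i t) / real (j t)) powr \<beta> * exp (ln (L (real (i t))) - ln (L (real (j t)))))
      \<longlongrightarrow> x powr \<beta> * exp 0) F"
    by (intro tendsto_mult tendsto_powr[OF ratio tendsto_const]) (use \<open>x > 0\<close> in auto)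
  moreover have "\<forall>\<^sub>F t in F. i t \<ge> 1" "\<forall>\<^sub>F t in F. j t \<ge> 1"
    using i j by (auto simp: filterlim_at_top)
  then have "\<forall>\<^sub>F t in F. (real (i t) / real (j t)) powr \<beta> * exp (ln (L (real (i t))) - ln (L (real (j t))))
      = rate (i t) / rate (j t)"
    by eventually_elim (simp add: rate_def exp_diff L_pos powr_divide)
  ultimately show ?thesis
    using tendsto_cong by force
qed

lemma summable_rates: "summable (\<lambda>k. 1 / rate (n + 1 + k))"
proof -
  \<comment> \<open>Half the excess of \<open>\<beta>\<close> over 1, which leaves the exponent
    \<open>(\<beta> + 1) / 2\<close>, still above 1.\<close>
  define \<delta> where "\<delta> = (\<beta> - 1) / 2"
  have \<delta>: "\<delta> > 0" "\<beta> - \<delta> > 1"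
    using beta by (auto simp: \<delta>_def field_simps)
  obtain N where N: "N \<ge> 1" and bound: "\<And>n m. N \<le> n \<Longrightarrow> n \<le> m \<Longrightarrow>
      rate n / rate m \<le> exp \<delta> * (real m / real n) powr - (\<beta> - \<delta>)"
    using rate_ratio_bound[OF \<delta>(1)] by blast
  have "summable (\<lambda>m. (exp \<delta> * real N powr (\<beta> - \<delta>) / rate N) * (real m powr - (\<beta> - \<delta>)))"
    using \<delta> by (intro summable_mult) (subst summable_real_powr_iff, simp)
  then have "summable (\<lambda>m. 1 / rate m)"
  proof (rule summable_comparison_test_ev[rotated])
    show "\<forall>\<^sub>F m in sequentially. norm (1 / rate m)
        \<le> (exp \<delta> * real N powr (\<beta> - \<delta>) / rate N) * (real m powr - (\<beta> - \<delta>))"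
      using eventually_ge_at_top[of N]
    proof eventually_elim
      case (elim m)
      have pos: "rate N > 0" "rate m > 0"
        using N elim by (auto intro!: rate_pos)
      have "1 / rate m = (rate N / rate m) / rate N"
        using pos by simp
      also have "\<dots> \<le> (exp \<delta> * (real m / real N) powr - (\<beta> - \<delta>)) / rate N"
        using bound[of N m] elim pos by (intro divide_right_mono) auto
      also have "(real m / real N) powr - (\<beta> - \<delta>) = real N powr (\<beta> - \<delta>) * real m powr - (\<beta> - \<delta>)"
        unfolding powr_minus powr_divide by (simp add: divide_inverse)
      also have "exp \<delta> * (real N powr (\<beta> - \<delta>) * real m powr - (\<beta> - \<delta>)) / rate N
          = (exp \<delta> * real N powr (\<beta> - \<delta>) / rate N) * (real m powr - (\<beta> - \<delta>))"
        by simp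
      finally show ?case using pos by simp
    qed
  qed
  then have "summable (\<lambda>k. 1 / rate (k + (n + 1)))"
    by (rule summable_ignore_initial_segment)
  then show ?thesis by (simp add: add_ac)
qed

text \<open>Dominated convergence for the step functions behind the sums. The bound on
  \<open>g\<close> is required up to some \<open>u0 > 1\<close>, not just up to 1, because the
  factor \<open>L\<close> need not leave the rates monotone: \<open>rate n / rate m\<close> may
  slightly exceed 1 for \<open>m > n\<close>.\<close>

lemma rate_sum_tendsto_integral:
  fixes g :: "real \<Rightarrow> real"
  assumes g [measurable]: "g \<in> borel_measurable borel"
    and cont: "\<And>u. 0 < u \<Longrightarrow> u \<le> 1 \<Longrightarrow> isCont g u"
    and "u0 > 1" and bound: "\<And>u. 0 \<le> u \<Longrightarrow> u \<le> u0 \<Longrightarrow> \<bar>g u\<bar> \<le> C * u"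
  shows "\<forall>\<^sub>F n in sequentially. (\<forall>k. rate n / rate (n + 1 + k) \<le> u0)
      \<and> summable (\<lambda>k. g (rate n / rate (n + 1 + k)))"
    and "(\<lambda>n. (\<Sum>k. g (rate n / rate (n + 1 + k))) / real n)
      \<longlonglongrightarrow> (LINT y:{1..}|lborel. g (y powr - \<beta>))"
proof -
  \<comment> \<open>The first entry keeps \<open>\<beta> - \<delta>\<close> above 1, so that the
    dominating power is integrable; the second keeps \<open>exp \<delta>\<close>, and with it all
    ratios from \<open>N\<close> on, at most \<open>u0\<close>.\<close>
  define \<delta> where "\<delta> = min ((\<beta> - 1) / 2) (ln u0)"
  have "(\<beta> - 1) / 2 > 0" "ln u0 > 0" using beta \<open>u0 > 1\<close> by auto
  then have \<delta>: "\<delta> > 0" by (simp add: \<delta>_def)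
  have "\<delta> \<le> (\<beta> - 1) / 2" unfolding \<delta>_def by (rule min.cobounded1)
  then have p: "\<beta> - \<delta> > 1" using beta by (simp add: field_simps)
  have "exp \<delta> \<le> exp (ln u0)" by (simp only: exp_le_cancel_iff) (simp add: \<delta>_def)
  then have exp_le: "exp \<delta> \<le> u0" using \<open>u0 > 1\<close> by simp
  have "C \<ge> 0"
    using bound[of 1] \<open>u0 > 1\<close> by (simp add: order_trans[OF abs_ge_zero])
  obtain N where N: "N \<ge> 1" and rbound: "\<And>n m. N \<le> n \<Longrightarrow> n \<le> m \<Longrightarrow>
      rate n / rate m \<le> exp \<delta> * (real m / real n) powr - (\<beta> - \<delta>)"
    using rate_ratio_bound[OF \<delta>(1)] by blast
  have nonneg: "rate n / rate m \<ge> 0" if "N \<le> n" "n \<le> m" for n m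
    using that N rate_pos[of n] rate_pos[of m] by simp
  have le_u0: "rate n / rate m \<le> u0" if "N \<le> n" "n \<le> m" for n m
  proof -
    have "(real m / real n) powr - (\<beta> - \<delta>) \<le> (real m / real n) powr 0"
      using that N p by (intro powr_mono) auto
    also have "\<dots> = 1"
      using that N by simp
    finally have "(real m / real n) powr - (\<beta> - \<delta>) \<le> 1" .
    from mult_left_mono[OF this, of "exp \<delta>"] have "exp \<delta> * (real m / real n) powr - (\<beta> - \<delta>) \<le> exp \<delta>"
      by simp
    then show ?thesis using rbound[OF that] exp_le by linarith
  qed
  have gbound: "\<bar>g (rate n / rate m)\<bar> \<le> C * (rate n / rate m)" if "N \<le> n" "n \<le> m" for n m
    using that by (intro bound nonneg le_u0)
  have abs_summable: "summable (\<lambda>k. \<bar>g (rate n / rate (n + 1 + k))\<bar>)" if "N \<le> n" for n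
  proof (rule summable_comparison_test')
    show "summable (\<lambda>k. (C * rate n) * (1 / rate (n + 1 + k)))"
      by (intro summable_mult summable_rates)
    show "norm \<bar>g (rate n / rate (n + 1 + k))\<bar> \<le> (C * rate n) * (1 / rate (n + 1 + k))" for k
      using gbound[of n "n + 1 + k"] that by simp
  qed
  show "\<forall>\<^sub>F n in sequentially. (\<forall>k. rate n / rate (n + 1 + k) \<le> u0)
      \<and> summable (\<lambda>k. g (rate n / rate (n + 1 + k)))"
    using eventually_ge_at_top[of N]
    by eventually_elim (intro conjI allI le_u0 summable_rabs_cancel[OF abs_summable]; simp)
  define f where "f n y = (if y \<ge> 1 then g (rate n / rate (n + 1 + (nat \<lfloor>real n * y\<rfloor> - n))) else 0)" for n y
  have f_eq: "f n y = g (rate n / rate (nat \<lfloor>real n * y\<rfloor> + 1))" if "y \<ge> 1" for n y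
  proof -
    have "real n \<le> real n * y" using that by (simp add: mult_le_cancel_left1)
    then have "n \<le> nat \<lfloor>real n * y\<rfloor>" by linarith
    then show ?thesis using that by (simp add: f_def)
  qed
  \<comment> \<open>Domination holds from \<open>N\<close> on only, while the convergence theorem
    asks for it at every index; the shift by \<open>N\<close> is undone by
    \<open>LIMSEQ_offset\<close>.\<close>
  have "(\<lambda>n. integral\<^sup>L lborel (f (n + N)))
      \<longlonglongrightarrow> integral\<^sup>L lborel (\<lambda>y. indicator {1..} y *\<^sub>R g (y powr - \<beta>))"
  proof (rule integral_dominated_convergence)
    show "(\<lambda>y. indicator {1..} y *\<^sub>R g (y powr - \<beta>)) \<in> borel_measurable lborel"
      by measurable
    show "f (n + N) \<in> borel_measurable lborel" for n
      using integral_staircase(2)[OF _ abs_summable[of "n + N"]] N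
      unfolding f_def by (intro borel_measurable_integrable) auto
    show "integrable lborel (\<lambda>y. indicator {1..} y *\<^sub>R (C * exp \<delta> * y powr - (\<beta> - \<delta>)))"
      using set_integrable_mult_right[OF powr_integrable_atLeast_one(1)[OF p], of "C * exp \<delta>"]
      unfolding set_integrable_def .
    show "AE y in lborel. (\<lambda>n. f (n + N) y) \<longlonglongrightarrow> indicator {1..} y *\<^sub>R g (y powr - \<beta>)"
    proof (rule AE_I2)
      fix y :: real
      show "(\<lambda>n. f (n + N) y) \<longlonglongrightarrow> indicator {1..} y *\<^sub>R g (y powr - \<beta>)"
      proof (cases "y \<ge> 1")
        case True
        define m where "m n = nat \<lfloor>real n * y\<rfloor> + 1" for n
        have m_ge: "real (m n) \<ge> real n * y" and m_le: "real (m n) \<le> real n * y + 1" for n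
          using True unfolding m_def by (auto simp: of_nat_nat) linarith+
        have m_top: "filterlim m at_top sequentially"
        proof (rule filterlim_at_top_mono[OF filterlim_ident])
          have "n \<le> m n" for n
            using m_ge[of n] True mult_left_mono[OF True, of "real n"] by simp
          then show "\<forall>\<^sub>F n in sequentially. n \<le> m n" by simp
        qed
        have "(\<lambda>n. real (m n) / real n) \<longlonglongrightarrow> y"
        proof (rule tendsto_sandwich)
          show "\<forall>\<^sub>F n in sequentially. y \<le> real (m n) / real n"
            using eventually_gt_at_top[of 0] by eventually_elim (use m_ge in \<open>simp add: field_simps\<close>)
          show "\<forall>\<^sub>F n in sequentially. real (m n) / real n \<le> y + 1 / real n"
            using eventually_gt_at_top[of 0] by eventually_elim (use m_le in \<open>simp add: field_simps\<close>)
          show "(\<lambda>n. y + 1 / real n) \<longlonglongrightarrow> y"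
            using tendsto_add[OF tendsto_const[of y] lim_1_over_n] by simp
        qed simp
        then have "(\<lambda>n. inverse (real (m n) / real n)) \<longlonglongrightarrow> inverse y"
          using True by (intro tendsto_inverse) auto
        then have "(\<lambda>n. rate n / rate (m n)) \<longlonglongrightarrow> inverse y powr \<beta>"
          using True by (intro rate_ratio_tendsto m_top filterlim_ident) auto
        also have "inverse y powr \<beta> = y powr - \<beta>"
          using True by (simp add: powr_minus inverse_powr)
        finally have "(\<lambda>n. rate n / rate (m n)) \<longlonglongrightarrow> y powr - \<beta>" .
        moreover have "y powr - \<beta> \<le> y powr 0"
          using True beta by (intro powr_mono) auto
        then have "isCont g (y powr - \<beta>)"
          using True by (intro cont) auto
        ultimately have "(\<lambda>n. g (rate n / rate (m n))) \<longlonglongrightarrow> g (y powr - \<beta>)"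
          by (rule isCont_tendsto_compose[rotated])
        then have "(\<lambda>n. f n y) \<longlonglongrightarrow> g (y powr - \<beta>)"
          using True by (simp add: f_eq m_def)
        then show ?thesis
          using True LIMSEQ_ignore_initial_segment[of "\<lambda>n. f n y" _ N] by simp
      qed (simp add: f_def)
    qed
    show "AE y in lborel. norm (f (n + N) y) \<le> indicator {1..} y *\<^sub>R (C * exp \<delta> * y powr - (\<beta> - \<delta>))" for n
    proof (rule AE_I2)
      fix y :: real
      show "norm (f (n + N) y) \<le> indicator {1..} y *\<^sub>R (C * exp \<delta> * y powr - (\<beta> - \<delta>))"
      proof (cases "y \<ge> 1")
        case True
        define k where "k = n + N"
        define m where "m = nat \<lfloor>real k * y\<rfloor> + 1"
        have k: "N \<le> k" "real k > 0" using N by (auto simp: k_def)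
        \<comment> \<open>The index belongs to the right end of the cell, so \<open>m / k\<close> is
          at least \<open>y\<close> and the decreasing power is bounded by its value at
          \<open>y\<close> itself.\<close>
        have "real k * y \<le> real m" unfolding m_def by linarith
        then have y: "y \<le> real m / real k" using k by (simp add: field_simps)
        have "real k \<le> real m"
          using \<open>real k * y \<le> real m\<close> mult_left_mono[OF True, of "real k"] by simp
        then have "k \<le> m" by simp
        have "norm (f k y) \<le> C * (rate k / rate m)"
          using gbound[OF k(1) \<open>k \<le> m\<close>] True by (simp add: f_eq m_def)
        also have "\<dots> \<le> C * (exp \<delta> * (real m / real k) powr - (\<beta> - \<delta>))"
          by (intro mult_left_mono rbound k \<open>k \<le> m\<close> \<open>C \<ge> 0\<close>)
        also have "\<dots> \<le> C * (exp \<delta> * y powr - (\<beta> - \<delta>))"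
          using y True p by (intro mult_left_mono powr_mono2' \<open>C \<ge> 0\<close>) auto
        finally show ?thesis using True by (simp add: k_def mult_ac)
      qed (simp add: f_def)
    qed
  qed
  moreover have "integral\<^sup>L lborel (f (n + N)) = (\<Sum>k. g (rate (n + N) / rate (n + N + 1 + k))) / real (n + N)" for n
    using integral_staircase(1)[OF _ abs_summable[of "n + N"]] N
    unfolding f_def by simp
  ultimately have "(\<lambda>n. (\<Sum>k. g (rate (n + N) / rate (n + N + 1 + k))) / real (n + N))
      \<longlonglongrightarrow> (LINT y:{1..}|lborel. g (y powr - \<beta>))"
    by (simp add: set_lebesgue_integral_def)
  then show "(\<lambda>n. (\<Sum>k. g (rate n / rate (n + 1 + k))) / real n)
      \<longlonglongrightarrow> (LINT y:{1..}|lborel. g (y powr - \<beta>))"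
    by (rule LIMSEQ_offset)
qed

end

section \<open>The limiting cumulant function and the rate function\<close>

text \<open>In both definitions \<open>s\<close> stands for \<open>(\<beta> - 1) \<tau>\<close>; \<open>phi\<close> is the derivative of \<open>cumulant\<close>.\<close>

definition phi :: "real \<Rightarrow> real \<Rightarrow> real" where
  "phi \<beta> s = (LINT y:{1..}|lborel. 1 / (y powr \<beta> - s))"

definition cumulant :: "real \<Rightarrow> real \<Rightarrow> real" where
  "cumulant \<beta> s = (LINT y:{1..}|lborel. - ln (1 - s * y powr - \<beta>))"

context
  fixes \<beta> :: real
  assumes beta: "\<beta> > 1"
begin

lemma powr_beta_bounds:
  assumes "y \<ge> 1"
  shows "1 \<le> y powr \<beta>" "0 < y powr - \<beta>" "y powr - \<beta> \<le> 1" "y powr - \<beta> = 1 / y powr \<beta>"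
proof -
  have "y powr 0 \<le> y powr \<beta>" using assms beta by (intro powr_mono) auto
  then show "1 \<le> y powr \<beta>" using assms by simp
  have "y powr - \<beta> \<le> y powr 0" using assms beta by (intro powr_mono) auto
  then show "y powr - \<beta> \<le> 1" using assms by simp
qed (use assms in \<open>auto simp: powr_minus divide_inverse\<close>)

lemma set_integrable_dominated_powr:
  fixes f :: "real \<Rightarrow> real"
  assumes [measurable]: "f \<in> borel_measurable borel"
    and le: "\<And>y. y \<ge> 1 \<Longrightarrow> \<bar>f y\<bar> \<le> C * y powr - \<beta>"
  shows "set_integrable lborel {1..} f"
proof -
  have "integrable lborel (\<lambda>y. indicator {1..} y *\<^sub>R f y)"
  proof (rule Bochner_Integration.integrable_bound)
    show "integrable lborel (\<lambda>y. indicator {1..} y *\<^sub>R (C * y powr - \<beta>))"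
      using set_integrable_mult_right[OF powr_integrable_atLeast_one(1)[OF beta], of C]
      unfolding set_integrable_def .
    show "AE y in lborel. norm (indicator {1..} y *\<^sub>R f y) \<le> norm (indicator {1..} y *\<^sub>R (C * y powr - \<beta>))"
      using le by (intro AE_I2) (auto simp: indicator_def intro: order_trans[OF _ abs_ge_self])
  qed measurable
  then show ?thesis by (simp add: set_integrable_def)
qed

text \<open>With \<open>m = min 1 (1 - s)\<close>, multiplying \<open>y powr \<beta> - 1\<close> by
  \<open>m\<close> can only shrink it, so \<open>y powr \<beta> - s\<close> is at least
  \<open>m * y powr \<beta>\<close> for either sign of \<open>s\<close>.\<close>

lemma inverse_powr_diff_bound:
  assumes "s < 1" "y \<ge> 1"
  shows "0 < 1 / (y powr \<beta> - s)" "1 / (y powr \<beta> - s) \<le> 1 / min 1 (1 - s) * y powr - \<beta>"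
proof -
  note b = powr_beta_bounds[OF \<open>y \<ge> 1\<close>]
  define m where "m = min 1 (1 - s)"
  have m: "0 < m" "m \<le> 1" "m \<le> 1 - s" using assms by (auto simp: m_def)
  have "(y powr \<beta> - 1) * m \<le> (y powr \<beta> - 1) * 1"
    using b m by (intro mult_left_mono) auto
  then have "m * y powr \<beta> \<le> y powr \<beta> - s"
    using m by (simp add: algebra_simps)
  moreover have "m * y powr \<beta> > 0"
    using m b by (intro mult_pos_pos) auto
  ultimately have "0 < y powr \<beta> - s" "1 / (y powr \<beta> - s) \<le> 1 / (m * y powr \<beta>)"
    by (auto intro!: divide_left_mono mult_pos_pos)
  then show "0 < 1 / (y powr \<beta> - s)" "1 / (y powr \<beta> - s) \<le> 1 / min 1 (1 - s) * y powr - \<beta>"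
    by (auto simp: b(4) m_def)
qed

lemma phi_integrable: "s < 1 \<Longrightarrow> set_integrable lborel {1..} (\<lambda>y. 1 / (y powr \<beta> - s))"
  using inverse_powr_diff_bound[of s]
  by (intro set_integrable_dominated_powr[where C = "1 / min 1 (1 - s)"]) (auto simp: less_imp_le)

lemma cumulant_integrable: "s < 1 \<Longrightarrow> set_integrable lborel {1..} (\<lambda>y. - ln (1 - s * y powr - \<beta>))"
proof (intro set_integrable_dominated_powr[where C = "\<bar>s\<bar> / min 1 (1 - s)"])
  fix y :: real assume "s < 1" "y \<ge> 1"
  then show "\<bar>- ln (1 - s * y powr - \<beta>)\<bar> \<le> \<bar>s\<bar> / min 1 (1 - s) * y powr - \<beta>"
    using ln_one_minus_mult_bound[of "y powr - \<beta>" 1 s] powr_beta_bounds(3)[of y] by simp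
qed measurable

lemma one_minus_mult_powr_pos:
  assumes "s < 1" "y \<ge> 1"
  shows "0 < 1 - s * y powr - \<beta>"
proof -
  have "y powr \<beta> > 0" "y powr \<beta> - s > 0"
    using assms powr_beta_bounds(1)[of y] by auto
  then show ?thesis
    unfolding powr_beta_bounds(4)[OF \<open>y \<ge> 1\<close>] by (simp add: field_simps)
qed

text \<open>Convexity with slope \<open>phi\<close>. Under the integral it is
  \<open>ln z \<le> z - 1\<close>, where \<open>z\<close> is the ratio of the two arguments of the
  logarithm.\<close>

lemma cumulant_subgradient:
  assumes "r < 1" "t < 1"
  shows "cumulant \<beta> t - cumulant \<beta> r \<le> (t - r) * phi \<beta> t"
proof -
  have "cumulant \<beta> t - cumulant \<beta> r
      = (LINT y:{1..}|lborel. - ln (1 - t * y powr - \<beta>) - - ln (1 - r * y powr - \<beta>))"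
    unfolding cumulant_def using assms by (intro set_integral_diff(2)[symmetric] cumulant_integrable)
  also have "\<dots> \<le> (LINT y:{1..}|lborel. (t - r) * (1 / (y powr \<beta> - t)))"
  proof (rule set_integral_mono)
    show "set_integrable lborel {1..} (\<lambda>y. - ln (1 - t * y powr - \<beta>) - - ln (1 - r * y powr - \<beta>))"
      using assms by (intro set_integral_diff(1) cumulant_integrable)
    show "set_integrable lborel {1..} (\<lambda>y. (t - r) * (1 / (y powr \<beta> - t)))"
      using assms by (intro set_integrable_mult_right phi_integrable)
    fix y :: real assume "y \<in> {1..}"
    then have "y \<ge> 1" by simp
    note p = one_minus_mult_powr_pos[OF \<open>r < 1\<close> this] one_minus_mult_powr_pos[OF \<open>t < 1\<close> this]
    have "- ln (1 - t * y powr - \<beta>) - - ln (1 - r * y powr - \<beta>)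
        = ln ((1 - r * y powr - \<beta>) / (1 - t * y powr - \<beta>))"
      using p by (simp add: ln_div)
    also have "\<dots> \<le> (1 - r * y powr - \<beta>) / (1 - t * y powr - \<beta>) - 1"
      using p by (intro ln_le_minus_one divide_pos_pos)
    also have "\<dots> = (t - r) * (1 / (y powr \<beta> - t))"
    proof -
      define w where "w = y powr \<beta>"
      have w: "w > 0" "w - t > 0"
        using powr_beta_bounds(1)[OF \<open>y \<ge> 1\<close>] \<open>t < 1\<close> by (auto simp: w_def)
      then have "1 - t * (1 / w) = (w - t) / w" "1 - r * (1 / w) = (w - r) / w"
        by (simp_all add: diff_divide_distrib)
      then show ?thesis
        using w unfolding powr_beta_bounds(4)[OF \<open>y \<ge> 1\<close>] w_def[symmetric]
        by (simp add: diff_divide_eq_iff divide_diff_eq_iff)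
    qed
    finally show "- ln (1 - t * y powr - \<beta>) - - ln (1 - r * y powr - \<beta>) \<le> (t - r) * (1 / (y powr \<beta> - t))" .
  qed
  also have "\<dots> = (t - r) * phi \<beta> t"
    unfolding phi_def by (rule set_integral_mult_right)
  finally show ?thesis .
qed

text \<open>The resolvent identity for \<open>1 / (w - s)\<close>. Its product form yields strict
  monotonicity through a lower bound on the integrand and continuity through an upper one.\<close>

lemma phi_diff:
  assumes "r < 1" "t < 1"
  shows "set_integrable lborel {1..} (\<lambda>y. (t - r) * (1 / (y powr \<beta> - t) * (1 / (y powr \<beta> - r))))"
    and "phi \<beta> t - phi \<beta> r = (LINT y:{1..}|lborel. (t - r) * (1 / (y powr \<beta> - t) * (1 / (y powr \<beta> - r))))"
proof -
  have eq: "1 / (y powr \<beta> - t) - 1 / (y powr \<beta> - r) = (t - r) * (1 / (y powr \<beta> - t) * (1 / (y powr \<beta> - r)))"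
    if "y \<in> {1..}" for y
  proof -
    have "y powr \<beta> - t \<noteq> 0" "y powr \<beta> - r \<noteq> 0"
      using that powr_beta_bounds(1)[of y] assms by auto
    then show ?thesis
      by (simp add: diff_frac_eq)
  qed
  have "set_integrable lborel {1..} (\<lambda>y. 1 / (y powr \<beta> - t) - 1 / (y powr \<beta> - r))"
    using assms by (intro set_integral_diff(1) phi_integrable)
  then show "set_integrable lborel {1..} (\<lambda>y. (t - r) * (1 / (y powr \<beta> - t) * (1 / (y powr \<beta> - r))))"
    by (rule iffD1[OF set_integrable_cong[OF refl refl eq], rotated])
  have "phi \<beta> t - phi \<beta> r = (LINT y:{1..}|lborel. 1 / (y powr \<beta> - t) - 1 / (y powr \<beta> - r))"
    unfolding phi_def using assms by (intro set_integral_diff(2)[symmetric] phi_integrable)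
  also have "\<dots> = (LINT y:{1..}|lborel. (t - r) * (1 / (y powr \<beta> - t) * (1 / (y powr \<beta> - r))))"
    using eq by (intro set_lebesgue_integral_cong) auto
  finally show "phi \<beta> t - phi \<beta> r = (LINT y:{1..}|lborel. (t - r) * (1 / (y powr \<beta> - t) * (1 / (y powr \<beta> - r))))" .
qed

lemma phi_strict_mono: "strict_mono_on {..<1} (phi \<beta>)"
proof (rule strict_mono_onI)
  fix r t :: real assume rt: "r \<in> {..<1}" "t \<in> {..<1}" "r < t"
  \<comment> \<open>Strictness must survive integration, so the integrand is bounded below by an
    explicit power. The factors \<open>1 + \<bar>t\<bar>\<close> and
    \<open>1 + \<bar>r\<bar>\<close> come from \<open>y powr \<beta> - s \<le> (1 + \<bar>s\<bar>) *
    y powr \<beta>\<close> at \<open>s = t\<close> and \<open>s = r\<close>.\<close>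
  define c where "c = (t - r) / ((1 + \<bar>t\<bar>) * (1 + \<bar>r\<bar>))"
  have "c > 0" using rt by (auto simp: c_def intro!: divide_pos_pos mult_pos_pos)
  have "0 < c * (1 / (2 * \<beta> - 1))"
    using \<open>c > 0\<close> beta by (intro mult_pos_pos divide_pos_pos) auto
  also have "\<dots> = (LINT y:{1..}|lborel. c * y powr - (2 * \<beta>))"
    using powr_integrable_atLeast_one(2)[of "2 * \<beta>"] beta by simp
  also have "\<dots> \<le> (LINT y:{1..}|lborel. (t - r) * (1 / (y powr \<beta> - t) * (1 / (y powr \<beta> - r))))"
  proof (rule set_integral_mono)
    show "set_integrable lborel {1..} (\<lambda>y. c * y powr - (2 * \<beta>))"
      using powr_integrable_atLeast_one(1)[of "2 * \<beta>"] beta by simp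
    show "set_integrable lborel {1..} (\<lambda>y. (t - r) * (1 / (y powr \<beta> - t) * (1 / (y powr \<beta> - r))))"
      using rt by (intro phi_diff) auto
    fix y :: real assume "y \<in> {1..}"
    then have y: "y \<ge> 1" by simp
    note b = powr_beta_bounds[OF y]
    have ge: "1 / ((1 + \<bar>s\<bar>) * y powr \<beta>) \<le> 1 / (y powr \<beta> - s)" if "s < 1" for s
    proof -
      have "\<bar>s\<bar> * 1 \<le> \<bar>s\<bar> * y powr \<beta>"
        using b by (intro mult_left_mono) auto
      then have "y powr \<beta> - s \<le> (1 + \<bar>s\<bar>) * y powr \<beta>"
        by (simp add: algebra_simps)
      moreover have "y powr \<beta> - s > 0"
        using b that by linarith
      ultimately show ?thesis
        by (intro divide_left_mono mult_pos_pos) auto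
    qed
    have "c * y powr - (2 * \<beta>) = (t - r) * (1 / ((1 + \<bar>t\<bar>) * y powr \<beta>) * (1 / ((1 + \<bar>r\<bar>) * y powr \<beta>)))"
    proof -
      have "y powr - (2 * \<beta>) = 1 / (y powr \<beta> * y powr \<beta>)"
        by (simp add: powr_minus divide_inverse flip: powr_add)
      then show ?thesis by (simp add: c_def)
    qed
    also have "\<dots> \<le> (t - r) * (1 / (y powr \<beta> - t) * (1 / (y powr \<beta> - r)))"
      using rt by (intro mult_left_mono mult_mono ge less_imp_le[OF inverse_powr_diff_bound(1)] y) auto
    finally show "c * y powr - (2 * \<beta>) \<le> (t - r) * (1 / (y powr \<beta> - t) * (1 / (y powr \<beta> - r)))" .
  qed
  also have "\<dots> = phi \<beta> t - phi \<beta> r"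
    using rt by (intro phi_diff(2)[symmetric]) auto
  finally show "phi \<beta> r < phi \<beta> t" by simp
qed

lemma phi_continuous: "continuous_on {..<1} (phi \<beta>)"
proof -
  have "isCont (phi \<beta>) s" if "s < 1" for s
  proof -
    \<comment> \<open>A cap below 1 keeps both arguments away from the value 1, where the
      denominator vanishes at \<open>y = 1\<close>. Under the cap one factor of the product is
      bounded and the other has integrable decay, which gives the Lipschitz constant
      \<open>K\<close>.\<close>
    obtain s0 where s0: "s < s0" "s0 < 1" using dense \<open>s < 1\<close> by blast
    define m where "m = min 1 (1 - s0)"
    have m: "m > 0" using s0 by (simp add: m_def)
    define K where "K = 1 / m * (1 / m) * (1 / (\<beta> - 1))"
    have lip: "\<bar>phi \<beta> t - phi \<beta> r\<bar> \<le> K * \<bar>t - r\<bar>" if "r \<le> s0" "t \<le> s0" for r t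
    proof -
      have rt: "r < 1" "t < 1" using that s0 by auto
      note I = phi_diff(1)[OF rt]
      have "\<bar>phi \<beta> t - phi \<beta> r\<bar> \<le> (LINT y:{1..}|lborel. \<bar>(t - r) * (1 / (y powr \<beta> - t) * (1 / (y powr \<beta> - r)))\<bar>)"
        unfolding phi_diff(2)[OF rt] using set_integral_norm_bound[OF I] by simp
      also have "\<dots> \<le> (LINT y:{1..}|lborel. \<bar>t - r\<bar> * (1 / m * (1 / m)) * y powr - \<beta>)"
      proof (rule set_integral_mono)
        show "set_integrable lborel {1..} (\<lambda>y. \<bar>(t - r) * (1 / (y powr \<beta> - t) * (1 / (y powr \<beta> - r)))\<bar>)"
          using I by (rule set_integrable_abs)
        show "set_integrable lborel {1..} (\<lambda>y. \<bar>t - r\<bar> * (1 / m * (1 / m)) * y powr - \<beta>)"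
          by (intro set_integrable_mult_right powr_integrable_atLeast_one beta)
        fix y :: real assume "y \<in> {1..}"
        then have y: "y \<ge> 1" by simp
        note b = powr_beta_bounds[OF y]
        have ub: "1 / (y powr \<beta> - q) \<le> 1 / m * y powr - \<beta>" "0 < 1 / (y powr \<beta> - q)" if "q \<le> s0" for q
        proof -
          have q: "q < 1" using that s0 by simp
          have "1 / (y powr \<beta> - q) \<le> 1 / min 1 (1 - q) * y powr - \<beta>"
            by (rule inverse_powr_diff_bound[OF q y])
          also have "\<dots> \<le> 1 / m * y powr - \<beta>"
            using that q m by (intro mult_right_mono divide_left_mono) (auto simp: m_def)
          finally show "1 / (y powr \<beta> - q) \<le> 1 / m * y powr - \<beta>" .
          show "0 < 1 / (y powr \<beta> - q)" by (rule inverse_powr_diff_bound[OF q y])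
        qed
        have "1 / m * y powr - \<beta> \<le> 1 / m * 1"
          using m b by (intro mult_left_mono) auto
        then have ub': "1 / (y powr \<beta> - t) \<le> 1 / m"
          using ub(1)[OF that(2)] by linarith
        have "\<bar>(t - r) * (1 / (y powr \<beta> - t) * (1 / (y powr \<beta> - r)))\<bar>
            = \<bar>t - r\<bar> * (1 / (y powr \<beta> - t) * (1 / (y powr \<beta> - r)))"
          using ub(2)[OF that(1)] ub(2)[OF that(2)] by (simp add: abs_mult)
        also have "\<dots> \<le> \<bar>t - r\<bar> * (1 / m * (1 / m * y powr - \<beta>))"
          using m by (intro mult_left_mono mult_mono ub' ub that less_imp_le[OF ub(2)]) auto
        finally show "\<bar>(t - r) * (1 / (y powr \<beta> - t) * (1 / (y powr \<beta> - r)))\<bar>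
            \<le> \<bar>t - r\<bar> * (1 / m * (1 / m)) * y powr - \<beta>"
          by (simp only: mult.assoc)
      qed
      also have "\<dots> = K * \<bar>t - r\<bar>"
        using powr_integrable_atLeast_one(2)[OF beta] by (simp add: K_def)
      finally show ?thesis .
    qed
    have "(phi \<beta> \<longlongrightarrow> phi \<beta> s) (at s)"
    proof (rule Lim_transform_bound[where g = "\<lambda>t. K * \<bar>t - s\<bar>", THEN LIM_zero_cancel])
      have "\<forall>\<^sub>F t in at s. t < s0"
        using order_tendstoD(2)[OF tendsto_ident_at s0(1)] by simp
      then show "\<forall>\<^sub>F t in at s. norm (phi \<beta> t - phi \<beta> s) \<le> norm (K * \<bar>t - s\<bar>)"
      proof eventually_elim
        case (elim t)
        then show ?case using lip[of s t] s0 by (auto intro: order_trans[OF _ abs_ge_self])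
      qed
      show "((\<lambda>t. K * \<bar>t - s\<bar>) \<longlongrightarrow> 0) (at s)"
        by (auto intro!: tendsto_eq_intros)
    qed
    then show ?thesis by (simp add: isCont_def)
  qed
  then show ?thesis by (auto intro: continuous_at_imp_continuous_on)
qed

text \<open>The boundary value of \<open>F\<close> at 1 supplies the term \<open>ln (1 - s)\<close>
  that reappears in \<open>rate_I\<close>; at infinity \<open>F y\<close> is of order
  \<open>y powr (1 - \<beta>)\<close> and contributes nothing.\<close>

lemma cumulant_eq:
  assumes s: "s < 1"
  shows "cumulant \<beta> s = ln (1 - s) + \<beta> * s * phi \<beta> s"
proof -
  \<comment> \<open>integration by parts\<close>
  define F where "F y = y * ln (1 - s * y powr - \<beta>)" for y
  define f where "f y = ln (1 - s * y powr - \<beta>) + \<beta> * s * (1 / (y powr \<beta> - s))" for y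
  have int_f: "set_integrable lborel {1..} f"
  proof -
    have "set_integrable lborel {1..} (\<lambda>y. - 1 * - ln (1 - s * y powr - \<beta>))"
      by (intro set_integrable_mult_right cumulant_integrable s)
    then have "set_integrable lborel {1..} (\<lambda>y. - 1 * - ln (1 - s * y powr - \<beta>) + \<beta> * s * (1 / (y powr \<beta> - s)))"
      by (rule set_integral_add(1)[OF _ set_integrable_mult_right[OF phi_integrable[OF s]]])
    then show ?thesis
      by (simp add: f_def[abs_def])
  qed
  have "(LINT y:{1..}|lborel. f y) = - cumulant \<beta> s + \<beta> * s * phi \<beta> s"
  proof -
    have *: "set_integrable lborel {1..} (\<lambda>y. \<beta> * s * (1 / (y powr \<beta> - s)))"
      by (intro set_integrable_mult_right phi_integrable s)
    have "(LINT y:{1..}|lborel. \<beta> * s * (1 / (y powr \<beta> - s)) - - ln (1 - s * y powr - \<beta>))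
        = \<beta> * s * phi \<beta> s - cumulant \<beta> s"
      unfolding set_integral_diff(2)[OF * cumulant_integrable[OF s]] set_integral_mult_right
        phi_def cumulant_def ..
    then show ?thesis by (simp add: f_def add.commute)
  qed
  moreover have "(LINT y:{1..}|lborel. f y) = - ln (1 - s)"
  proof (rule tendsto_unique[OF trivial_limit_at_top_linorder])
    show "((\<lambda>b. LINT y:{1..b}|lborel. f y) \<longlongrightarrow> (LINT y:{1..}|lborel. f y)) at_top"
      by (rule tendsto_set_lebesgue_integral_at_top) (use int_f in auto)
    have "\<forall>\<^sub>F b in at_top. (LINT y:{1..b}|lborel. f y) = F b - F 1"
      using eventually_ge_at_top[of 1]
    proof eventually_elim
      case (elim b)
      have "(f has_integral F b - F 1) {1..b}"
      proof (rule fundamental_theorem_of_calculus[OF elim])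
        fix y :: real assume "y \<in> {1..b}"
        then have y: "y \<ge> 1" by simp
        note p = one_minus_mult_powr_pos[OF s y] inverse_powr_diff_bound(1)[OF s y] powr_beta_bounds[OF y]
        have "(F has_real_derivative
            1 * ln (1 - s * y powr - \<beta>) + (1 / (1 - s * y powr - \<beta>) * (0 - s * (- \<beta> * y powr (- \<beta> - 1)))) * y) (at y)"
          unfolding F_def using p y
          by (auto intro!: derivative_eq_intros)
        also have "(1 / (1 - s * y powr - \<beta>) * (0 - s * (- \<beta> * y powr (- \<beta> - 1)))) * y
            = \<beta> * s * ((y powr (- \<beta> - 1) * y) / (1 - s * y powr - \<beta>))"
          by simp
        also have "y powr (- \<beta> - 1) * y = y powr - \<beta>"
          using y by (simp add: powr_diff)
        also have "y powr - \<beta> / (1 - s * y powr - \<beta>) = 1 / (y powr \<beta> - s)"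
        proof -
          have "y powr \<beta> > 0" "y powr \<beta> - s > 0" using p y by auto
          then show ?thesis unfolding p(6) by (simp add: field_simps)
        qed
        finally show "(F has_vector_derivative f y) (at y within {1..b})"
          by (simp add: f_def has_real_derivative_iff_has_vector_derivative has_vector_derivative_at_within)
      qed
      moreover have "set_integrable lborel {1..b} f"
        by (rule set_integrable_subset[OF int_f]) auto
      ultimately show ?case
        using set_borel_integral_eq_integral(2) integral_unique by metis
    qed
    moreover have "(F \<longlongrightarrow> 0) at_top"
    proof (rule Lim_null_comparison)
      show "\<forall>\<^sub>F y in at_top. norm (F y) \<le> \<bar>s\<bar> / min 1 (1 - s) * y powr (1 - \<beta>)"
        using eventually_ge_at_top[of 1]
      proof eventually_elim
        case (elim y)
        note b = powr_beta_bounds[OF elim]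
        have "norm (F y) = y * \<bar>ln (1 - s * y powr - \<beta>)\<bar>"
          using elim by (simp add: F_def abs_mult)
        also have "\<dots> \<le> y * (\<bar>s\<bar> / min 1 (1 - s) * y powr - \<beta>)"
          using ln_one_minus_mult_bound[of "y powr - \<beta>" 1 s] b s elim by (intro mult_left_mono) auto
        also have "\<dots> = \<bar>s\<bar> / min 1 (1 - s) * y powr (1 - \<beta>)"
          using elim by (simp add: powr_diff powr_minus divide_inverse)
        finally show ?case .
      qed
      have "((\<lambda>y::real. y powr (1 - \<beta>)) \<longlongrightarrow> 0) at_top"
        by (rule tendsto_neg_powr[OF _ filterlim_ident]) (use beta in simp)
      then show "((\<lambda>y. \<bar>s\<bar> / min 1 (1 - s) * y powr (1 - \<beta>)) \<longlongrightarrow> 0) at_top"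
        by (rule tendsto_mult_right_zero)
    qed
    then have "((\<lambda>b. F b - F 1) \<longlongrightarrow> 0 - F 1) at_top"
      by (intro tendsto_intros)
    ultimately show "((\<lambda>b. LINT y:{1..b}|lborel. f y) \<longlongrightarrow> - ln (1 - s)) at_top"
      using tendsto_cong by (force simp: F_def)
  qed
  ultimately show ?thesis by simp
qed

text \<open>Towards minus infinity \<open>phi\<close> tends to 0 by dominated convergence, towards 1
  it is unbounded, and continuity fills the gap. An explicit point \<open>b\<close> below 1 replaces
  a limit at 1, where the integrand turns singular.\<close>

lemma phi_surj:
  assumes "x > 0"
  obtains s where "s < 1" "phi \<beta> s = x"
proof -
  define f where "f n y = indicator {1..} y *\<^sub>R (1 / (y powr \<beta> - - real n))" for n y
  have "(\<lambda>n. integral\<^sup>L lborel (f n)) \<longlonglongrightarrow> integral\<^sup>L lborel (\<lambda>y::real. 0::real)"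
    unfolding f_def
  proof (rule integral_dominated_convergence)
    show "integrable lborel (\<lambda>y. indicator {1..} y *\<^sub>R (y powr - \<beta>))"
      using powr_integrable_atLeast_one(1)[OF beta] by (simp add: set_integrable_def)
    show "AE y in lborel. norm (indicator {1..} y *\<^sub>R (1 / (y powr \<beta> - - real n))) \<le> indicator {1..} y *\<^sub>R (y powr - \<beta>)" for n
    proof (rule AE_I2)
      fix y :: real
      show "norm (indicator {1..} y *\<^sub>R (1 / (y powr \<beta> - - real n))) \<le> indicator {1..} y *\<^sub>R (y powr - \<beta>)"
        using powr_beta_bounds[of y] by (auto simp: indicator_def intro!: divide_left_mono)
    qed
    show "AE y in lborel. (\<lambda>n. indicator {1..} y *\<^sub>R (1 / (y powr \<beta> - - real n))) \<longlonglongrightarrow> 0"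
    proof (rule AE_I2)
      fix y :: real
      have "filterlim (\<lambda>n. y powr \<beta> + real n) at_top sequentially"
        by (intro filterlim_tendsto_add_at_top[OF tendsto_const] filterlim_real_sequentially)
      then have "(\<lambda>n. 1 / (y powr \<beta> + real n)) \<longlonglongrightarrow> 0"
        by (intro tendsto_divide_0[OF tendsto_const] filterlim_at_top_imp_at_infinity)
      then show "(\<lambda>n. indicator {1..} y *\<^sub>R (1 / (y powr \<beta> - - real n))) \<longlonglongrightarrow> 0"
        using tendsto_scaleR[OF tendsto_const, of _ 0] by fastforce
    qed
  qed measurable
  moreover have "integral\<^sup>L lborel (f n) = phi \<beta> (- real n)" for n
    by (simp add: f_def[abs_def] phi_def set_lebesgue_integral_def)
  ultimately have "\<forall>\<^sub>F n in sequentially. phi \<beta> (- real n) < x"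
    using assms by (intro order_tendstoD) auto
  then obtain n where n: "phi \<beta> (- real n) < x"
    by (auto simp: eventually_sequentially)
  \<comment> \<open>At this point \<open>cumulant_eq\<close> and \<open>cumulant \<beta> b \<ge> 0\<close> give \<open>phi \<beta> b \<ge> x\<close>.\<close>
  define b where "b = 1 - exp (- \<beta> * x)"
  have b: "0 < b" "b < 1"
    using assms beta by (auto simp: b_def)
  have "cumulant \<beta> b \<ge> 0"
    unfolding cumulant_def set_lebesgue_integral_def
  proof (rule Bochner_Integration.integral_nonneg)
    fix y :: real
    show "0 \<le> indicator {1..} y *\<^sub>R - ln (1 - b * y powr - \<beta>)"
    proof (cases "y \<ge> 1")
      case True
      have "b * y powr - \<beta> \<ge> 0" using b by simp
      then have "ln (1 - b * y powr - \<beta>) \<le> 0"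
        using one_minus_mult_powr_pos[OF b(2) True] by (intro ln_le_zero_iff[THEN iffD2]) auto
      then show ?thesis using True by simp
    qed simp
  qed
  then have "- ln (1 - b) \<le> \<beta> * b * phi \<beta> b"
    using cumulant_eq[OF b(2)] by simp
  then have "\<beta> * x \<le> \<beta> * (b * phi \<beta> b)"
    by (simp add: b_def mult.assoc)
  then have "x \<le> b * phi \<beta> b"
    using beta by simp
  moreover from this have "phi \<beta> b > 0"
    using assms b by (metis less_le_trans zero_less_mult_pos)
  then have "b * phi \<beta> b \<le> 1 * phi \<beta> b"
    using b by (intro mult_right_mono) auto
  ultimately have "x \<le> phi \<beta> b" by simp
  moreover have "continuous_on {- real n..b} (phi \<beta>)"
    by (rule continuous_on_subset[OF phi_continuous]) (use b in auto)
  ultimately obtain s where "s \<le> b" "phi \<beta> s = x"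
    using IVT'[of "phi \<beta>" "- real n" x b] n b by auto
  then show thesis using that[of s] b by simp
qed

lemma phi_0: "phi \<beta> 0 = 1 / (\<beta> - 1)"
proof -
  have "phi \<beta> 0 = (LINT y:{1..}|lborel. y powr - \<beta>)"
    unfolding phi_def by (intro set_lebesgue_integral_cong) (auto simp: powr_minus divide_inverse)
  then show ?thesis
    using powr_integrable_atLeast_one(2)[OF beta] by simp
qed

text \<open>Scaling turns the defining integral of \<open>tau\<close> into
  \<open>(\<beta> - 1) * phi\<close>, and the uniqueness demanded by \<open>THE\<close> is the
  injectivity of \<open>phi\<close>.\<close>

lemma tau_eq:
  assumes s: "s < 1" and x: "(\<beta> - 1) * phi \<beta> s = x"
  shows "tau \<beta> x = s / (\<beta> - 1)"
proof -
  have hi: "((\<lambda>y. 1 / (y powr \<beta> / (\<beta> - 1) - r / (\<beta> - 1))) has_integral (\<beta> - 1) * phi \<beta> r) {1..}"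
    if "r < 1" for r
  proof -
    have "((\<lambda>y. 1 / (y powr \<beta> - r)) has_integral phi \<beta> r) {1..}"
      using set_borel_integral_eq_integral[OF phi_integrable[OF that]]
      by (simp add: phi_def integrable_integral)
    then have "((\<lambda>y. (\<beta> - 1) * (1 / (y powr \<beta> - r))) has_integral (\<beta> - 1) * phi \<beta> r) {1..}"
      by (rule has_integral_mult_right)
    also have "(\<lambda>y. (\<beta> - 1) * (1 / (y powr \<beta> - r))) = (\<lambda>y. 1 / (y powr \<beta> / (\<beta> - 1) - r / (\<beta> - 1)))"
      using beta by (simp flip: diff_divide_distrib)
    finally show ?thesis .
  qed
  show ?thesis
    unfolding tau_def
  proof (rule the_equality)
    show "s / (\<beta> - 1) < 1 / (\<beta> - 1) \<and>
        ((\<lambda>y. 1 / (y powr \<beta> / (\<beta> - 1) - s / (\<beta> - 1))) has_integral x) {1..}"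
      using hi[OF s] s beta x by (simp add: divide_strict_right_mono)
  next
    fix \<tau> assume \<tau>: "\<tau> < 1 / (\<beta> - 1) \<and> ((\<lambda>y. 1 / (y powr \<beta> / (\<beta> - 1) - \<tau>)) has_integral x) {1..}"
    define r where "r = (\<beta> - 1) * \<tau>"
    have r: "r < 1" "\<tau> = r / (\<beta> - 1)"
      using \<tau> beta by (auto simp: r_def field_simps)
    have "(\<beta> - 1) * phi \<beta> r = (\<beta> - 1) * phi \<beta> s"
      using has_integral_unique[OF hi[OF r(1)]] \<tau> r(2) x by auto
    then have "phi \<beta> r = phi \<beta> s" using beta by simp
    then have "r = s"
      using strict_mono_on_imp_inj_on[OF phi_strict_mono] r(1) s by (auto dest: inj_onD)
    then show "\<tau> = s / (\<beta> - 1)" using r(2) by simp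
  qed
qed

text \<open>After integration by parts, subtracting \<open>s * phi \<beta> s\<close> lowers its
  coefficient from \<open>\<beta>\<close> to \<open>\<beta> - 1\<close>, and the expression
  collapses to \<open>s * x + ln (1 - s)\<close>.\<close>

lemma rate_I_eq:
  assumes s: "s < 1" and x: "(\<beta> - 1) * phi \<beta> s = x"
  shows "- rate_I \<beta> x = cumulant \<beta> s - s * phi \<beta> s"
proof -
  have "- (\<beta> - 1) * x * (s / (\<beta> - 1)) = - (s * x)" "(\<beta> - 1) * (s / (\<beta> - 1)) = s"
    using beta by (auto simp: field_simps)
  then have "- rate_I \<beta> x = s * x + ln (1 - s)"
    unfolding rate_I_def tau_eq[OF assms] by simp
  then show ?thesis
    unfolding cumulant_eq[OF s] x[symmetric] by (simp add: algebra_simps)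
qed

end

section \<open>The death process\<close>

text \<open>Serves both the means and almost every path. Holding times start at state 2, so strict
  decrease is available from \<open>n = 1\<close> on.\<close>

lemma tail_series:
  fixes f :: "nat \<Rightarrow> real"
  assumes pos: "\<And>k. k \<ge> 2 \<Longrightarrow> f k > 0" and sm: "summable f"
  defines "T \<equiv> \<lambda>n. \<Sum>k. f (n + 1 + k)"
  shows "n \<ge> 1 \<Longrightarrow> T (Suc n) < T n" and "T \<longlonglongrightarrow> 0"
proof -
  have T: "T n = (\<Sum>k. f (k + (n + 1)))" for n
    by (simp add: T_def add_ac)
  show "T (Suc n) < T n" if "n \<ge> 1"
  proof -
    have "T n = f (n + 1) + T (Suc n)"
      using suminf_split_head[OF summable_ignore_initial_segment[OF sm], of "n + 1"]
      by (simp add: T)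
    then show ?thesis using pos[of "n + 1"] that by simp
  qed
  have "T = (\<lambda>n. suminf f - (\<Sum>k<Suc n. f k))"
  proof
    show "T n = suminf f - (\<Sum>k<Suc n. f k)" for n
      using suminf_minus_initial_segment[OF sm, of "n + 1"] by (simp add: T)
  qed
  moreover have "(\<lambda>n. suminf f - (\<Sum>k<Suc n. f k)) \<longlonglongrightarrow> suminf f - suminf f"
    by (intro tendsto_intros LIMSEQ_Suc summable_LIMSEQ sm)
  ultimately show "T \<longlonglongrightarrow> 0"
    by (simp only: diff_self)
qed

text \<open>Shared by the process and the speed, both defined through \<open>LEAST\<close>.
  \<open>N\<close> is the first index whose value is at most \<open>t\<close>; by monotonicity it is
  the only solution of the two-sided condition. Index 0 is left out because that hitting time would
  involve \<open>X 1\<close>, about which nothing is assumed.\<close>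

lemma decreasing_first_passage:
  fixes T :: "nat \<Rightarrow> real"
  assumes dec: "\<And>n. n \<ge> 1 \<Longrightarrow> T (Suc n) < T n" and lim: "T \<longlonglongrightarrow> 0" and "t > 0"
  obtains N where "N \<ge> 1" "\<And>m. m \<ge> 1 \<Longrightarrow> T m \<le> t \<longleftrightarrow> N \<le> m"
    "T 1 > t \<Longrightarrow> N \<ge> 2 \<and> (\<forall>n. n \<ge> 2 \<and> T n \<le> t \<and> t < T (n - 1) \<longleftrightarrow> n = N)"
proof -
  have mono: "T m \<le> T n" if "1 \<le> n" "n \<le> m" for m n
    using that(2,1) by (induction rule: dec_induct) (auto intro: order_trans[OF less_imp_le[OF dec]])
  have "\<forall>\<^sub>F n in sequentially. T n < t"
    using lim \<open>t > 0\<close> by (rule order_tendstoD)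
  then obtain n0 where n0: "\<And>n. n \<ge> n0 \<Longrightarrow> T n < t"
    by (auto simp: eventually_sequentially)
  have ex: "n0 + 1 \<ge> 1 \<and> T (n0 + 1) \<le> t" using n0[of "n0 + 1"] by simp
  define N where "N = (LEAST n. n \<ge> 1 \<and> T n \<le> t)"
  have N: "N \<ge> 1" "T N \<le> t"
    using LeastI[of "\<lambda>n. n \<ge> 1 \<and> T n \<le> t", OF ex] by (auto simp: N_def)
  have iff: "T m \<le> t \<longleftrightarrow> N \<le> m" if "m \<ge> 1" for m
  proof
    show "N \<le> m" if "T m \<le> t"
      unfolding N_def using \<open>m \<ge> 1\<close> that by (intro Least_le) simp
    show "T m \<le> t" if "N \<le> m"
      using mono[OF N(1) that] N(2) by simp
  qed
  show thesis
  proof (rule that[OF N(1) iff])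
    assume "T 1 > t"
    then have "N \<ge> 2"
      using iff[of 1] N(1) by simp
    moreover have "n \<ge> 2 \<and> T n \<le> t \<and> t < T (n - 1) \<longleftrightarrow> n = N" for n
    proof (cases "n \<ge> 2")
      case True
      then have "T n \<le> t \<longleftrightarrow> N \<le> n" "t < T (n - 1) \<longleftrightarrow> n - 1 < N"
        using iff[of n] iff[of "n - 1"] by (simp_all add: not_le flip: linorder_not_le)
      then show ?thesis using True by auto
    next
      case False
      then show ?thesis using \<open>N \<ge> 2\<close> by auto
    qed
    ultimately show "N \<ge> 2 \<and> (\<forall>n. n \<ge> 2 \<and> T n \<le> t \<and> t < T (n - 1) \<longleftrightarrow> n = N)"
      by blast
  qed
qed

lemma death_process_le_iff:
  assumes dec: "\<And>n. n \<ge> 1 \<Longrightarrow> hitting_time X (Suc n) \<omega> < hitting_time X n \<omega>"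
    and lim: "(\<lambda>n. hitting_time X n \<omega>) \<longlonglongrightarrow> 0" and "t > 0" "m \<ge> 1"
  shows "death_process X t \<omega> \<le> enat m \<longleftrightarrow> hitting_time X m \<omega> \<le> t"
proof -
  obtain N where N: "N \<ge> 1" "\<And>m. m \<ge> 1 \<Longrightarrow> hitting_time X m \<omega> \<le> t \<longleftrightarrow> N \<le> m"
    "hitting_time X 1 \<omega> > t \<Longrightarrow> N \<ge> 2 \<and> (\<forall>n. n \<ge> 2 \<and> hitting_time X n \<omega> \<le> t \<and> t < hitting_time X (n - 1) \<omega> \<longleftrightarrow> n = N)"
    using decreasing_first_passage[OF dec lim \<open>t > 0\<close>] by metis
  have "death_process X t \<omega> = enat N"
  proof (cases "hitting_time X 1 \<omega> \<le> t")
    case True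
    then have "N = 1" using N(1) N(2)[of 1] by simp
    then show ?thesis using True \<open>t > 0\<close> by (simp add: death_process_def one_enat_def)
  next
    case False
    then have *: "N \<ge> 2" "\<And>n. (n \<ge> 2 \<and> hitting_time X n \<omega> \<le> t \<and> t < hitting_time X (n - 1) \<omega>) = (n = N)"
      using N(3) by auto
    have "\<exists>n\<ge>2. hitting_time X n \<omega> \<le> t \<and> t < hitting_time X (n - 1) \<omega>"
      using * by blast
    then show ?thesis
      using False \<open>t > 0\<close> unfolding death_process_def * by (simp add: Least_equality)
  qed
  then show ?thesis using N(2)[OF \<open>m \<ge> 1\<close>] by simp
qed

lemma speed_le_iff:
  assumes dec: "\<And>n. n \<ge> 1 \<Longrightarrow> mean_hitting_time M X (Suc n) < mean_hitting_time M X n"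
    and lim: "mean_hitting_time M X \<longlonglongrightarrow> 0" and "t > 0" "m \<ge> 1"
  shows "speed M X t \<le> m \<longleftrightarrow> mean_hitting_time M X m \<le> t"
    and "speed M X t \<ge> 1"
proof -
  obtain N where N: "N \<ge> 1" "\<And>m. m \<ge> 1 \<Longrightarrow> mean_hitting_time M X m \<le> t \<longleftrightarrow> N \<le> m"
    "mean_hitting_time M X 1 > t \<Longrightarrow> N \<ge> 2 \<and> (\<forall>n. n \<ge> 2 \<and> mean_hitting_time M X n \<le> t \<and> t < mean_hitting_time M X (n - 1) \<longleftrightarrow> n = N)"
    using decreasing_first_passage[OF dec lim \<open>t > 0\<close>] by metis
  have "speed M X t = N"
  proof (cases "mean_hitting_time M X 1 \<le> t")
    case True
    then have "N = 1" using N(1) N(2)[of 1] by simp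
    then show ?thesis using True by (simp add: speed_def)
  next
    case False
    then have *: "\<And>n. (n \<ge> 2 \<and> mean_hitting_time M X n \<le> t \<and> t < mean_hitting_time M X (n - 1)) = (n = N)"
      using N(3) by auto
    show ?thesis
      using False unfolding speed_def * by (simp add: Least_equality)
  qed
  then show "speed M X t \<le> m \<longleftrightarrow> mean_hitting_time M X m \<le> t" "speed M X t \<ge> 1"
    using N(1) N(2)[OF \<open>m \<ge> 1\<close>] by auto
qed

lemma ereal_of_enat_gt_iff:
  assumes "r \<ge> 0"
  shows "ereal_of_enat z > ereal r \<longleftrightarrow> \<not> z \<le> enat (nat \<lfloor>r\<rfloor>)"
proof (cases z)
  case (enat n)
  then show ?thesis using assms by simp linarith
qed simp

text \<open>The largest integer strictly below \<open>r\<close> is the ceiling minus one, also when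
  \<open>r\<close> is itself an integer. Positivity of \<open>r\<close> keeps the natural
  subtraction from truncating.\<close>

lemma ereal_of_enat_less_iff:
  assumes "r > 0"
  shows "ereal_of_enat z < ereal r \<longleftrightarrow> z \<le> enat (nat \<lceil>r\<rceil> - 1)"
proof (cases z)
  case (enat n)
  then show ?thesis using assms by simp linarith
qed simp

lemma (in prob_space) indep_vars_reindex:
  assumes f: "inj_on f I" and ind: "indep_vars M' X (f ` I)"
  shows "indep_vars (\<lambda>i. M' (f i)) (\<lambda>i. X (f i)) I"
  unfolding indep_vars_def2
proof (intro conjI ballI)
  show "random_variable (M' (f i)) (X (f i))" if "i \<in> I" for i
    using ind that by (auto simp: indep_vars_def2)
  define G where "G i = {X i -` A \<inter> space M |A. A \<in> sets (M' i)}" for i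
  have G: "indep_sets G (f ` I)"
    using ind by (simp add: indep_vars_def2 G_def[abs_def])
  have "indep_sets (\<lambda>i. G (f i)) I"
    unfolding indep_sets_def
  proof (intro conjI ballI allI impI)
    show "G (f i) \<subseteq> events" if "i \<in> I" for i
      using G that by (auto simp: indep_sets_def)
    fix J A assume J: "J \<subseteq> I" "J \<noteq> {}" "finite J" and A: "A \<in> Pi J (\<lambda>i. G (f i))"
    have fJ: "inj_on f J" using f J by (auto intro: inj_on_subset)
    define B where "B j = A (inv_into J f j)" for j
    have B: "B (f i) = A i" if "i \<in> J" for i
      using that fJ by (simp add: B_def)
    have "prob (\<Inter>j\<in>f ` J. B j) = (\<Prod>j\<in>f ` J. prob (B j))"
      by (rule indep_setsD[OF G]) (use J A B in auto)
    then show "prob (\<Inter>i\<in>J. A i) = (\<Prod>i\<in>J. prob (A i))"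
      using B by (simp add: prod.reindex[OF fJ])
  qed
  then show "indep_sets (\<lambda>i. {X (f i) -` A \<inter> space M |A. A \<in> sets (M' (f i))}) I"
    by (simp add: G_def)
qed

section \<open>Hitting times: means and exponential moments\<close>

locale pure_death = prob_space M + regularly_varying_rates \<beta> L
  for M :: "'a measure" and \<beta> :: real and L :: "real \<Rightarrow> real" +
  fixes X :: "nat \<Rightarrow> 'a \<Rightarrow> real"
  assumes indep: "indep_vars (\<lambda>_. borel) X {2..}"
    and distributed_X: "\<And>n. n \<ge> 2 \<Longrightarrow> distributed M lborel (X n) (exponential_density (rate n))"
begin

abbreviation T :: "nat \<Rightarrow> 'a \<Rightarrow> real" where
  "T \<equiv> hitting_time X"

abbreviation A :: "nat \<Rightarrow> real" where
  "A \<equiv> mean_hitting_time M X"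

lemma exponential_series_tail:
  assumes "n \<ge> 1"
  shows "exponential_series M (\<lambda>k. X (n + 1 + k)) (\<lambda>k. rate (n + 1 + k))"
proof
  have "indep_vars (\<lambda>_. borel) X ((+) (n + 1) ` UNIV)"
    by (rule indep_vars_subset[OF indep]) (use assms in auto)
  from indep_vars_reindex[OF _ this]
  show "indep_vars (\<lambda>_. borel) (\<lambda>k. X (n + 1 + k)) UNIV"
    by simp
  show "distributed M lborel (X (n + 1 + k)) (exponential_density (rate (n + 1 + k)))" for k
    using assms by (intro distributed_X) simp
  show "rate (n + 1 + k) > 0" for k by (rule rate_pos) simp
  show "summable (\<lambda>k. 1 / rate (n + 1 + k))" by (rule summable_rates)
qed

lemma measurable_T [measurable]: "n \<ge> 1 \<Longrightarrow> random_variable borel (T n)"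
  using borel_measurable_suminf[OF exponential_series.measurable_X[OF exponential_series_tail]]
  by (simp add: hitting_time_def[abs_def])

lemma A_eq: "n \<ge> 1 \<Longrightarrow> A n = (\<Sum>k. 1 / rate (n + 1 + k))"
  using exponential_series.expectation_series[OF exponential_series_tail]
  by (simp add: mean_hitting_time_def hitting_time_def[abs_def])

lemma A_strict_decreasing: "n \<ge> 1 \<Longrightarrow> A (Suc n) < A n"
  and A_tendsto_0: "A \<longlonglongrightarrow> 0"
proof -
  have sm: "summable (\<lambda>k. 1 / rate k)"
    using summable_rates[of 0] summable_iff_shift[of "\<lambda>k. 1 / rate k" 1] by simp
  have pos: "k \<ge> 2 \<Longrightarrow> 1 / rate k > 0" for k
    using rate_pos[of k] by simp
  note tail = tail_series[OF pos sm]
  show "A (Suc n) < A n" if "n \<ge> 1"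
    using tail(1)[OF _ that] that by (simp add: A_eq)
  have "\<forall>\<^sub>F n in sequentially. (\<Sum>k. 1 / rate (n + 1 + k)) = A n"
    using eventually_ge_at_top[of 1] by eventually_elim (simp add: A_eq)
  with tail(2) show "A \<longlonglongrightarrow> 0"
    by (rule Lim_transform_eventually)
qed

lemma A_pos:
  assumes "n \<ge> 1"
  shows "A n > 0"
proof -
  have "(\<Sum>k. 1 / rate (n + 1 + k)) > 0"
    by (intro suminf_pos summable_rates) (simp add: rate_pos)
  then show ?thesis using assms by (simp add: A_eq)
qed

lemma AE_hitting_times:
  "AE \<omega> in M. (\<forall>n\<ge>1. T (Suc n) \<omega> < T n \<omega>) \<and> (\<lambda>n. T n \<omega>) \<longlonglongrightarrow> 0"
proof -
  interpret S: exponential_series M "\<lambda>k. X (1 + 1 + k)" "\<lambda>k. rate (1 + 1 + k)"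
    by (rule exponential_series_tail) simp
  show ?thesis
    using S.AE_X_pos S.AE_summable
  proof eventually_elim
    case (elim \<omega>)
    have pos: "X k \<omega> > 0" if "k \<ge> 2" for k
    proof -
      have "1 + 1 + (k - 2) = k" using that by simp
      then show ?thesis using elim(1)[rule_format, of "k - 2"] by (simp only:)
    qed
    have sm: "summable (\<lambda>k. X k \<omega>)"
      using elim(2) summable_iff_shift[of "\<lambda>k. X k \<omega>" 2] by (simp add: add_ac)
    show ?case
      using tail_series[of "\<lambda>k. X k \<omega>", OF pos sm] by (auto simp: hitting_time_def)
  qed
qed

text \<open>The identity function in the Riemann sum theorem gives Karamata asymptotics for the tail
  sums. This converts thresholds in units of \<open>A n\<close> into thresholds in units of
  \<open>n / rate n\<close>.\<close>

lemma A_asymptotics: "(\<lambda>n. A n * rate n / real n) \<longlonglongrightarrow> 1 / (\<beta> - 1)"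
proof -
  have "(\<lambda>n. (\<Sum>k. rate n / rate (n + 1 + k)) / real n) \<longlonglongrightarrow> (LINT y:{1..}|lborel. y powr - \<beta>)"
    by (rule rate_sum_tendsto_integral(2)[of "\<lambda>u. u" 2 1]) auto
  then have "(\<lambda>n. (\<Sum>k. rate n / rate (n + 1 + k)) / real n) \<longlonglongrightarrow> 1 / (\<beta> - 1)"
    using powr_integrable_atLeast_one(2)[OF beta] by simp
  moreover have "\<forall>\<^sub>F n in sequentially. (\<Sum>k. rate n / rate (n + 1 + k)) / real n = A n * rate n / real n"
    using eventually_ge_at_top[of 1]
  proof eventually_elim
    case (elim n)
    show ?case
      using suminf_mult[OF summable_rates[of n], of "rate n"] elim by (simp add: A_eq mult.commute)
  qed
  ultimately show ?thesis
    by (rule Lim_transform_eventually)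
qed

lemma cumulant_generating:
  assumes "r < 1"
  shows "\<forall>\<^sub>F n in sequentially. integrable M (\<lambda>\<omega>. exp (r * rate n * T n \<omega>))"
    and "(\<lambda>n. ln (expectation (\<lambda>\<omega>. exp (r * rate n * T n \<omega>))) / real n) \<longlonglongrightarrow> cumulant \<beta> r"
proof -
  \<comment> \<open>Ratios of rates may slightly exceed 1, so the logarithm has to be controlled up
    to some \<open>u0 > 1\<close> with \<open>r * u0 < 1\<close>. For positive \<open>r\<close> this
    is the midpoint of 1 and \<open>1 / r\<close>.\<close>
  define u0 :: real where "u0 = (if r \<le> 0 then 2 else (1 + 1 / r) / 2)"
  have u0: "u0 > 1" "r * u0 < 1"
    using assms by (auto simp: u0_def field_simps)
  define g where "g u = - ln (1 - r * u)" for u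
  have bound: "\<bar>g u\<bar> \<le> \<bar>r\<bar> / min 1 (1 - r * u0) * u" if "0 \<le> u" "u \<le> u0" for u
    using ln_one_minus_mult_bound[OF that u0(2)] by (simp add: g_def)
  have cont: "isCont g u" if "0 < u" "u \<le> 1" for u
  proof -
    have "r * u < 1"
    proof (cases "r \<ge> 0")
      case True
      then have "r * u \<le> r * 1" using that by (intro mult_left_mono)
      then show ?thesis using assms by simp
    next
      case False
      then have "r * u \<le> 0" using that by (simp add: mult_nonpos_nonneg)
      then show ?thesis by simp
    qed
    then show ?thesis
      unfolding g_def by (intro continuous_intros) auto
  qed
  have meas: "g \<in> borel_measurable borel"
    unfolding g_def by measurable
  have sums: "\<forall>\<^sub>F n in sequentially. (\<forall>k. rate n / rate (n + 1 + k) \<le> u0)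
      \<and> summable (\<lambda>k. g (rate n / rate (n + 1 + k)))"
    "(\<lambda>n. (\<Sum>k. g (rate n / rate (n + 1 + k))) / real n)
      \<longlonglongrightarrow> (LINT y:{1..}|lborel. g (y powr - \<beta>))"
    by (rule rate_sum_tendsto_integral[OF meas _ u0(1)], fact cont, fact bound)+
  have ev: "\<forall>\<^sub>F n in sequentially. integrable M (\<lambda>\<omega>. exp (r * rate n * T n \<omega>)) \<and>
      ln (expectation (\<lambda>\<omega>. exp (r * rate n * T n \<omega>))) = (\<Sum>k. g (rate n / rate (n + 1 + k)))"
    using sums(1) eventually_ge_at_top[of 1]
  proof eventually_elim
    case (elim n)
    interpret S: exponential_series M "\<lambda>k. X (n + 1 + k)" "\<lambda>k. rate (n + 1 + k)"
      by (rule exponential_series_tail) fact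
    \<comment> \<open>The moment formula requires an exponent below every rate of the tail; the cap
      \<open>u0\<close> provides this for all \<open>k\<close> at once.\<close>
    have less: "r * rate n < rate (n + 1 + k)" for k
    proof -
      have pos: "rate n > 0" "rate (n + 1 + k) > 0"
        using elim by (auto intro: rate_pos)
      have "r * (rate n / rate (n + 1 + k)) < 1"
      proof (cases "r \<ge> 0")
        case True
        then have "r * (rate n / rate (n + 1 + k)) \<le> r * u0"
          using elim by (intro mult_left_mono) auto
        then show ?thesis using u0 by simp
      next
        case False
        then have "r * (rate n / rate (n + 1 + k)) \<le> 0"
          using pos by (intro mult_nonpos_nonneg) auto
        then show ?thesis by simp
      qed
      then show ?thesis using pos by (simp add: field_simps)
    qed
    have g_eq: "- ln (1 - r * rate n / rate (n + 1 + k)) = g (rate n / rate (n + 1 + k))" for k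
      by (simp add: g_def)
    have "summable (\<lambda>k. - ln (1 - r * rate n / rate (n + 1 + k)))"
      unfolding g_eq using elim by simp
    from S.exponential_moment_series[OF less this]
    show ?case
      unfolding g_eq by (simp add: hitting_time_def)
  qed
  then show "\<forall>\<^sub>F n in sequentially. integrable M (\<lambda>\<omega>. exp (r * rate n * T n \<omega>))"
    by eventually_elim simp
  have "\<forall>\<^sub>F n in sequentially. (\<Sum>k. g (rate n / rate (n + 1 + k))) / real n
      = ln (expectation (\<lambda>\<omega>. exp (r * rate n * T n \<omega>))) / real n"
    using ev by eventually_elim simp
  with sums(2) have "(\<lambda>n. ln (expectation (\<lambda>\<omega>. exp (r * rate n * T n \<omega>))) / real n)
      \<longlonglongrightarrow> (LINT y:{1..}|lborel. g (y powr - \<beta>))"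
    by (rule Lim_transform_eventually)
  then show "(\<lambda>n. ln (expectation (\<lambda>\<omega>. exp (r * rate n * T n \<omega>))) / real n) \<longlonglongrightarrow> cumulant \<beta> r"
    by (simp add: g_def cumulant_def)
qed

text \<open>For the process the index is a function of \<open>t\<close> that grows as
  \<open>t\<close> tends to 0, hence the general filter. The exponent is brought into the shape
  \<open>r * a i * Y i\<close> of \<open>upper_tail_rate\<close>.\<close>

lemma cumulant_generating_filter:
  assumes k: "filterlim k at_top F" and "r < 1"
  shows "\<forall>\<^sub>F i in F. integrable M (\<lambda>\<omega>. exp (r * real (k i) * (rate (k i) * T (k i) \<omega> / real (k i))))"
    and "((\<lambda>i. ln (expectation (\<lambda>\<omega>. exp (r * real (k i) * (rate (k i) * T (k i) \<omega> / real (k i))))) / real (k i))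
      \<longlongrightarrow> cumulant \<beta> r) F"
proof -
  have k1: "\<forall>\<^sub>F i in F. k i \<ge> 1"
    using k by (simp add: filterlim_at_top)
  have eq: "r * real n * (rate n * T n \<omega> / real n) = r * rate n * T n \<omega>" if "n \<ge> 1" for n \<omega>
    using that by simp
  show "\<forall>\<^sub>F i in F. integrable M (\<lambda>\<omega>. exp (r * real (k i) * (rate (k i) * T (k i) \<omega> / real (k i))))"
    using eventually_compose_filterlim[OF cumulant_generating(1)[OF \<open>r < 1\<close>] k] k1
    by eventually_elim (simp only: eq)
  have "\<forall>\<^sub>F i in F. ln (expectation (\<lambda>\<omega>. exp (r * rate (k i) * T (k i) \<omega>))) / real (k i)
      = ln (expectation (\<lambda>\<omega>. exp (r * real (k i) * (rate (k i) * T (k i) \<omega> / real (k i))))) / real (k i)"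
    using k1 by eventually_elim (simp only: eq)
  with filterlim_compose[OF cumulant_generating(2)[OF \<open>r < 1\<close>] k]
  show "((\<lambda>i. ln (expectation (\<lambda>\<omega>. exp (r * real (k i) * (rate (k i) * T (k i) \<omega> / real (k i))))) / real (k i))
      \<longlongrightarrow> cumulant \<beta> r) F"
    by (rule Lim_transform_eventually)
qed

section \<open>Tails of the hitting times\<close>

lemma scaled_event_iff:
  assumes "n \<ge> 1"
  shows "rate n * T n \<omega> / real n > t * rate n / real n \<longleftrightarrow> T n \<omega> > t"
    and "rate n * T n \<omega> / real n \<ge> t * rate n / real n \<longleftrightarrow> T n \<omega> \<ge> t"
    and "rate n * T n \<omega> / real n < t * rate n / real n \<longleftrightarrow> T n \<omega> < t"
    and "rate n * T n \<omega> / real n \<le> t * rate n / real n \<longleftrightarrow> T n \<omega> \<le> t"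
proof -
  define c where "c = rate n / real n"
  have "c > 0" using assms rate_pos[OF assms] by (simp add: c_def)
  moreover have "rate n * T n \<omega> / real n = T n \<omega> * c" "t * rate n / real n = t * c"
    by (simp_all add: c_def)
  ultimately show "rate n * T n \<omega> / real n > t * rate n / real n \<longleftrightarrow> T n \<omega> > t"
    "rate n * T n \<omega> / real n \<ge> t * rate n / real n \<longleftrightarrow> T n \<omega> \<ge> t"
    "rate n * T n \<omega> / real n < t * rate n / real n \<longleftrightarrow> T n \<omega> < t"
    "rate n * T n \<omega> / real n \<le> t * rate n / real n \<longleftrightarrow> T n \<omega> \<le> t"
    by (simp_all only: mult_less_cancel_right_pos mult_le_cancel_right_pos)
qed

text \<open>The level \<open>x / (\<beta> - 1)\<close> equals \<open>phi \<beta> s\<close> for some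
  \<open>s < 1\<close>, and \<open>x \<ge> 1\<close> means \<open>s \<ge> 0\<close> because
  \<open>phi \<beta> 0 = 1 / (\<beta> - 1)\<close>. This is the sign that
  \<open>upper_tail_rate\<close> asks for.\<close>

lemma hitting_time_upper_tail:
  fixes k :: "'i \<Rightarrow> nat" and t p :: "'i \<Rightarrow> real"
  assumes k: "filterlim k at_top F" and "x \<ge> 1"
    and t: "((\<lambda>i. t i * rate (k i) / real (k i)) \<longlongrightarrow> x / (\<beta> - 1)) F"
    and p: "\<forall>\<^sub>F i in F. prob {\<omega> \<in> space M. T (k i) \<omega> > t i} \<le> p i"
      "\<forall>\<^sub>F i in F. p i \<le> prob {\<omega> \<in> space M. T (k i) \<omega> \<ge> t i}"
  shows "((\<lambda>i. ln (p i) / real (k i)) \<longlongrightarrow> - rate_I \<beta> x) F"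
proof -
  have "x / (\<beta> - 1) > 0" using \<open>x \<ge> 1\<close> beta by simp
  then obtain s where s: "s < 1" "phi \<beta> s = x / (\<beta> - 1)"
    using phi_surj[OF beta] by blast
  have "s \<ge> 0"
  proof (rule ccontr)
    assume "\<not> s \<ge> 0"
    then have "phi \<beta> s < phi \<beta> 0"
      using strict_mono_onD[OF phi_strict_mono[OF beta], of s 0] by simp
    then show False
      using \<open>x \<ge> 1\<close> beta by (simp add: s(2) phi_0[OF beta] divide_less_cancel)
  qed
  have k1: "\<forall>\<^sub>F i in F. k i \<ge> 1"
    using k by (simp add: filterlim_at_top)
  have x: "(\<beta> - 1) * phi \<beta> s = x" using beta by (simp add: s(2))
  have "((\<lambda>i. ln (p i) / real (k i)) \<longlongrightarrow> cumulant \<beta> s - s * phi \<beta> s) F"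
  proof (rule upper_tail_rate[where U = "{..<1}" and c = "\<lambda>i. t i * rate (k i) / real (k i)"
        and Y = "\<lambda>i \<omega>. rate (k i) * T (k i) \<omega> / real (k i)"])
    show "\<forall>\<^sub>F i in F. random_variable borel (\<lambda>\<omega>. rate (k i) * T (k i) \<omega> / real (k i))"
      using k1 by eventually_elim measurable
    show "filterlim (\<lambda>i. real (k i)) at_top F"
      by (rule filterlim_compose[OF filterlim_real_sequentially k])
    show "((\<lambda>i. t i * rate (k i) / real (k i)) \<longlongrightarrow> phi \<beta> s) F"
      unfolding s(2) by (rule t)
    show "\<forall>\<^sub>F i in F. prob {\<omega> \<in> space M. t i * rate (k i) / real (k i) < rate (k i) * T (k i) \<omega> / real (k i)} \<le> p i"
      using p(1) k1 by eventually_elim (simp add: scaled_event_iff)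
    show "\<forall>\<^sub>F i in F. p i \<le> prob {\<omega> \<in> space M. t i * rate (k i) / real (k i) \<le> rate (k i) * T (k i) \<omega> / real (k i)}"
      using p(2) k1 by eventually_elim (simp add: scaled_event_iff)
  next
    fix r :: real assume "r \<in> {..<1}"
    then show "\<forall>\<^sub>F i in F. integrable M (\<lambda>\<omega>. exp (r * real (k i) * (rate (k i) * T (k i) \<omega> / real (k i))))"
      "((\<lambda>i. ln (expectation (\<lambda>\<omega>. exp (r * real (k i) * (rate (k i) * T (k i) \<omega> / real (k i))))) / real (k i))
        \<longlongrightarrow> cumulant \<beta> r) F"
      by (intro cumulant_generating_filter[OF k]; simp)+
  next
    fix r q :: real assume "r \<in> {..<1}" "q \<in> {..<1}"
    then show "cumulant \<beta> q - cumulant \<beta> r \<le> (q - r) * phi \<beta> q"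
      by (intro cumulant_subgradient[OF beta]) auto
  qed (use s \<open>s \<ge> 0\<close> phi_strict_mono[OF beta] phi_continuous[OF beta] in simp_all)
  then show ?thesis
    using rate_I_eq[OF beta s(1) x] by simp
qed

text \<open>Reflection: \<open>upper_tail_rate\<close> is applied to the negated variable, whose
  cumulant function is \<open>cumulant \<beta> (- r)\<close> with slope
  \<open>- phi \<beta> (- r)\<close> for \<open>r > -1\<close>, at the exponent
  \<open>- s \<ge> 0\<close>. The two signs in the product of exponent and slope cancel, so the rate
  has the same formula on both sides.\<close>

lemma hitting_time_lower_tail:
  fixes k :: "'i \<Rightarrow> nat" and t p :: "'i \<Rightarrow> real"
  assumes k: "filterlim k at_top F" and "0 < x" "x \<le> 1"
    and t: "((\<lambda>i. t i * rate (k i) / real (k i)) \<longlongrightarrow> x / (\<beta> - 1)) F"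
    and p: "\<forall>\<^sub>F i in F. prob {\<omega> \<in> space M. T (k i) \<omega> < t i} \<le> p i"
      "\<forall>\<^sub>F i in F. p i \<le> prob {\<omega> \<in> space M. T (k i) \<omega> \<le> t i}"
  shows "((\<lambda>i. ln (p i) / real (k i)) \<longlongrightarrow> - rate_I \<beta> x) F"
proof -
  have "x / (\<beta> - 1) > 0" using \<open>0 < x\<close> beta by simp
  then obtain s where s: "s < 1" "phi \<beta> s = x / (\<beta> - 1)"
    using phi_surj[OF beta] by blast
  have "s \<le> 0"
  proof (rule ccontr)
    assume "\<not> s \<le> 0"
    then have "phi \<beta> 0 < phi \<beta> s"
      using strict_mono_onD[OF phi_strict_mono[OF beta], of 0 s] s(1) by simp
    then show False
      using \<open>x \<le> 1\<close> beta by (simp add: s(2) phi_0[OF beta] divide_less_cancel)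
  qed
  have k1: "\<forall>\<^sub>F i in F. k i \<ge> 1"
    using k by (simp add: filterlim_at_top)
  have x: "(\<beta> - 1) * phi \<beta> s = x" using beta by (simp add: s(2))
  have "((\<lambda>i. ln (p i) / real (k i)) \<longlongrightarrow> cumulant \<beta> (- (- s)) - (- s) * (- phi \<beta> (- (- s)))) F"
  proof (rule upper_tail_rate[where U = "{-1<..}" and c = "\<lambda>i. - (t i * rate (k i) / real (k i))"
        and Y = "\<lambda>i \<omega>. - (rate (k i) * T (k i) \<omega> / real (k i))" and \<Lambda> = "\<lambda>r. cumulant \<beta> (- r)"
        and \<Phi> = "\<lambda>r. - phi \<beta> (- r)" and s = "- s"])
    show "\<forall>\<^sub>F i in F. random_variable borel (\<lambda>\<omega>. - (rate (k i) * T (k i) \<omega> / real (k i)))"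
      using k1 by eventually_elim measurable
    show "filterlim (\<lambda>i. real (k i)) at_top F"
      by (rule filterlim_compose[OF filterlim_real_sequentially k])
    show "((\<lambda>i. - (t i * rate (k i) / real (k i))) \<longlongrightarrow> - phi \<beta> (- (- s))) F"
      unfolding minus_minus s(2) by (intro tendsto_minus t)
    show "\<forall>\<^sub>F i in F. prob {\<omega> \<in> space M. - (t i * rate (k i) / real (k i)) < - (rate (k i) * T (k i) \<omega> / real (k i))} \<le> p i"
      using p(1) k1 by eventually_elim (simp add: scaled_event_iff)
    show "\<forall>\<^sub>F i in F. p i \<le> prob {\<omega> \<in> space M. - (t i * rate (k i) / real (k i)) \<le> - (rate (k i) * T (k i) \<omega> / real (k i))}"
      using p(2) k1 by eventually_elim (simp add: scaled_event_iff)
    show "strict_mono_on {-1<..} (\<lambda>r. - phi \<beta> (- r))"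
      by (auto intro!: strict_mono_onI strict_mono_onD[OF phi_strict_mono[OF beta]])
    show "continuous_on {-1<..} (\<lambda>r. - phi \<beta> (- r))"
      by (intro continuous_on_minus continuous_on_compose2[OF phi_continuous[OF beta]] continuous_on_id) auto
  next
    fix r q :: real assume "r \<in> {-1<..}" "q \<in> {-1<..}"
    then show "cumulant \<beta> (- q) - cumulant \<beta> (- r) \<le> (q - r) * - phi \<beta> (- q)"
      using cumulant_subgradient[OF beta, of "- r" "- q"] by (simp add: algebra_simps)
  next
    fix r :: real assume "r \<in> {-1<..}"
    then have r: "- r < 1" by simp
    show "\<forall>\<^sub>F i in F. integrable M (\<lambda>\<omega>. exp (r * real (k i) * - (rate (k i) * T (k i) \<omega> / real (k i))))"
      using cumulant_generating_filter(1)[OF k r] by (simp only: mult_minus_left mult_minus_right)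
    show "((\<lambda>i. ln (expectation (\<lambda>\<omega>. exp (r * real (k i) * - (rate (k i) * T (k i) \<omega> / real (k i))))) / real (k i))
        \<longlongrightarrow> cumulant \<beta> (- r)) F"
      using cumulant_generating_filter(2)[OF k r] by (simp only: mult_minus_left mult_minus_right)
  qed (use s \<open>s \<le> 0\<close> in simp_all)
  then show ?thesis
    using rate_I_eq[OF beta s(1) x] by simp
qed

section \<open>Asymptotics of the speed\<close>

lemma speed_at_top: "filterlim (speed M X) at_top (at_right 0)"
  unfolding filterlim_at_top
proof
  fix K :: nat
  have "A (max 1 K) > 0" by (rule A_pos) simp
  then have "\<forall>\<^sub>F t in at_right 0. 0 < t \<and> t < A (max 1 K)"
    by (auto simp: eventually_at_right_field)
  then show "\<forall>\<^sub>F t in at_right 0. K \<le> speed M X t"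
  proof eventually_elim
    case (elim t)
    then show ?case
      using speed_le_iff(1)[OF A_strict_decreasing A_tendsto_0, of t "max 1 K"] by simp
  qed
qed

text \<open>For \<open>v = speed M X t\<close> at least 2, \<open>t\<close> lies between
  \<open>A v\<close> and \<open>A (v - 1)\<close>. Both ends have the same asymptotics, since
  passing from \<open>v - 1\<close> to \<open>v\<close> changes rate and index by factors tending to
  1.\<close>

lemma speed_asymptotics:
  "((\<lambda>t. t * rate (speed M X t) / real (speed M X t)) \<longlongrightarrow> 1 / (\<beta> - 1)) (at_right 0)"
proof (rule tendsto_sandwich)
  let ?v = "speed M X"
  have ev: "\<forall>\<^sub>F t in at_right 0. 0 < t \<and> ?v t \<ge> 2"
    using speed_at_top by (auto simp: filterlim_at_top eventually_at_right_less intro: eventually_conj)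
  show "\<forall>\<^sub>F t in at_right 0. A (?v t) * rate (?v t) / real (?v t) \<le> t * rate (?v t) / real (?v t)"
    using ev
  proof eventually_elim
    case (elim t)
    then have "A (?v t) \<le> t"
      using speed_le_iff(1)[OF A_strict_decreasing A_tendsto_0, of t "?v t"] by simp
    then show ?case
      using elim rate_pos[of "?v t"] by (intro divide_right_mono mult_right_mono) auto
  qed
  show "\<forall>\<^sub>F t in at_right 0. t * rate (?v t) / real (?v t) \<le>
      A (?v t - 1) * rate (?v t - 1) / real (?v t - 1) * (rate (?v t) / rate (?v t - 1)) * (1 - 1 / real (?v t))"
    using ev
  proof eventually_elim
    case (elim t)
    then have "?v t \<le> ?v t - 1 \<longleftrightarrow> A (?v t - 1) \<le> t"
      by (intro speed_le_iff(1)[OF A_strict_decreasing A_tendsto_0]) auto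
    then have "t < A (?v t - 1)"
      using elim by linarith
    then have "t * rate (?v t) / real (?v t) \<le> A (?v t - 1) * rate (?v t) / real (?v t)"
      using elim rate_pos[of "?v t"] by (intro divide_right_mono mult_right_mono) auto
    also have "\<dots> = A (?v t - 1) * rate (?v t - 1) / real (?v t - 1) * (rate (?v t) / rate (?v t - 1)) * (1 - 1 / real (?v t))"
    proof -
      have "1 - 1 / real (?v t) = real (?v t - 1) / real (?v t)" "real (?v t - 1) > 0"
        using elim by (auto simp: field_simps of_nat_diff)
      moreover have "rate (?v t - 1) > 0"
        using elim by (intro rate_pos) linarith
      ultimately show ?thesis
        by simp
    qed
    finally show ?case .
  qed
  show "((\<lambda>t. A (?v t) * rate (?v t) / real (?v t)) \<longlongrightarrow> 1 / (\<beta> - 1)) (at_right 0)"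
    by (rule filterlim_compose[OF A_asymptotics speed_at_top])
  have v1: "filterlim (\<lambda>t. ?v t - 1) at_top (at_right 0)"
    by (rule filterlim_compose[OF filterlim_minus_const_nat_at_top speed_at_top])
  have "((\<lambda>n. real n / real (n - 1)) \<longlongrightarrow> 1) sequentially"
    by real_asymp
  then have "((\<lambda>t. real (?v t) / real (?v t - 1)) \<longlongrightarrow> 1) (at_right 0)"
    by (rule filterlim_compose[OF _ speed_at_top])
  then have ratio: "((\<lambda>t. rate (?v t) / rate (?v t - 1)) \<longlongrightarrow> 1 powr \<beta>) (at_right 0)"
    by (intro rate_ratio_tendsto speed_at_top v1) auto
  have inv: "((\<lambda>t. 1 / real (?v t)) \<longlongrightarrow> 0) (at_right 0)"
    by (rule filterlim_compose[OF lim_1_over_n speed_at_top])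
  have "((\<lambda>t. A (?v t - 1) * rate (?v t - 1) / real (?v t - 1) * (rate (?v t) / rate (?v t - 1)) * (1 - 1 / real (?v t)))
      \<longlongrightarrow> 1 / (\<beta> - 1) * 1 powr \<beta> * (1 - 0)) (at_right 0)"
    by (intro tendsto_mult tendsto_diff tendsto_const ratio inv filterlim_compose[OF A_asymptotics v1])
  then show "((\<lambda>t. A (?v t - 1) * rate (?v t - 1) / real (?v t - 1) * (rate (?v t) / rate (?v t - 1)) * (1 - 1 / real (?v t)))
      \<longlongrightarrow> 1 / (\<beta> - 1)) (at_right 0)"
    by simp
qed

text \<open>An error of one unit accommodates both the floor and the ceiling minus one. Compared
  with the speed, the rate gains the factor \<open>x powr \<beta>\<close> and the index the factor
  \<open>x\<close>; their quotient is the argument of \<open>I\<close> inside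
  \<open>J\<close>.\<close>

lemma scaled_speed_asymptotics:
  fixes m :: "real \<Rightarrow> nat"
  assumes "x > 0" and m: "\<And>t. \<bar>real (m t) - x * real (speed M X t)\<bar> \<le> 1"
  shows "((\<lambda>t. real (m t) / real (speed M X t)) \<longlongrightarrow> x) (at_right 0)"
    and "filterlim m at_top (at_right 0)"
    and "((\<lambda>t. t * rate (m t) / real (m t)) \<longlongrightarrow> x powr (\<beta> - 1) / (\<beta> - 1)) (at_right 0)"
proof -
  let ?v = "speed M X"
  have v: "filterlim (\<lambda>t. real (?v t)) at_top (at_right 0)"
    by (rule filterlim_compose[OF filterlim_real_sequentially speed_at_top])
  have ev: "\<forall>\<^sub>F t in at_right 0. ?v t \<ge> 1"
    using speed_at_top by (simp add: filterlim_at_top)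
  have inv: "((\<lambda>t. 1 / real (?v t)) \<longlongrightarrow> 0) (at_right 0)"
    by (rule filterlim_compose[OF lim_1_over_n speed_at_top])
  have "((\<lambda>t. real (m t) / real (?v t) - x) \<longlongrightarrow> 0) (at_right 0)"
  proof (rule Lim_null_comparison[OF _ inv])
    show "\<forall>\<^sub>F t in at_right 0. norm (real (m t) / real (?v t) - x) \<le> 1 / real (?v t)"
      using ev
    proof eventually_elim
      case (elim t)
      have "real (m t) / real (?v t) - x = (real (m t) - x * real (?v t)) / real (?v t)"
        using elim by (simp add: diff_divide_distrib)
      then have "norm (real (m t) / real (?v t) - x) = \<bar>real (m t) - x * real (?v t)\<bar> / real (?v t)"
        by (simp add: abs_divide)
      also have "\<dots> \<le> 1 / real (?v t)"
        using m[of t] by (intro divide_right_mono) auto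
      finally show ?case .
    qed
  qed
  then show ratio: "((\<lambda>t. real (m t) / real (?v t)) \<longlongrightarrow> x) (at_right 0)"
    by (rule LIM_zero_cancel)
  have "filterlim (\<lambda>t. - 1 + x * real (?v t)) at_top (at_right 0)"
    by (intro filterlim_tendsto_add_at_top[OF tendsto_const] filterlim_tendsto_pos_mult_at_top[OF tendsto_const \<open>x > 0\<close>] v)
  then have "filterlim (\<lambda>t. real (m t)) at_top (at_right 0)"
  proof (rule filterlim_at_top_mono)
    have "- 1 + x * real (?v t) \<le> real (m t)" for t
      using m[of t] by linarith
    then show "\<forall>\<^sub>F t in at_right 0. - 1 + x * real (?v t) \<le> real (m t)"
      by simp
  qed
  then show m_top: "filterlim m at_top (at_right 0)"
    by (simp add: filterlim_sequentially_iff_filterlim_real)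
  have limit_eq: "1 / (\<beta> - 1) * x powr \<beta> * inverse x = x powr (\<beta> - 1) / (\<beta> - 1)"
    using \<open>x > 0\<close> by (simp add: powr_diff divide_inverse)
  have "((\<lambda>t. (t * rate (?v t) / real (?v t)) * (rate (m t) / rate (?v t)) * inverse (real (m t) / real (?v t)))
      \<longlongrightarrow> 1 / (\<beta> - 1) * x powr \<beta> * inverse x) (at_right 0)"
    by (intro tendsto_mult tendsto_inverse speed_asymptotics ratio rate_ratio_tendsto m_top speed_at_top)
      (use \<open>x > 0\<close> in auto)
  then have "((\<lambda>t. (t * rate (?v t) / real (?v t)) * (rate (m t) / rate (?v t)) * inverse (real (m t) / real (?v t)))
      \<longlongrightarrow> x powr (\<beta> - 1) / (\<beta> - 1)) (at_right 0)"
    unfolding limit_eq .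
  moreover have "\<forall>\<^sub>F t in at_right 0. (t * rate (?v t) / real (?v t)) * (rate (m t) / rate (?v t)) * inverse (real (m t) / real (?v t))
      = t * rate (m t) / real (m t)"
    using ev
  proof eventually_elim
    case (elim t)
    then have "rate (?v t) > 0" "real (?v t) > 0" by (auto intro: rate_pos)
    then show ?case by simp
  qed
  ultimately show "((\<lambda>t. t * rate (m t) / real (m t)) \<longlongrightarrow> x powr (\<beta> - 1) / (\<beta> - 1)) (at_right 0)"
    by (rule Lim_transform_eventually)
qed

section \<open>Transfer from hitting times to the process\<close>

lemma measurable_death_process: "death_process X t \<in> M \<rightarrow>\<^sub>M count_space UNIV"
proof -
  define P where "P n \<omega> \<longleftrightarrow> n \<ge> 2 \<and> T n \<omega> \<le> t \<and> t < T (n - 1) \<omega>" for n \<omega>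
  have [measurable]: "Measurable.pred M (P n)" for n
  proof (cases "n \<ge> 2")
    case True
    then have [measurable]: "random_variable borel (T n)" "random_variable borel (T (n - 1))"
      by (auto intro: measurable_T)
    show ?thesis unfolding P_def by measurable
  qed (simp add: P_def[abs_def])
  have [measurable]: "random_variable borel (T 1)"
    by (rule measurable_T) simp
  have "death_process X t = (\<lambda>\<omega>. if t = 0 then \<infinity> else if T 1 \<omega> \<le> t then 1
      else if \<exists>n. P n \<omega> then enat (LEAST n. P n \<omega>) else \<infinity>)"
    by (auto simp: death_process_def P_def fun_eq_iff)
  then show ?thesis
    by simp measurable
qed

text \<open>The events agree only almost surely, because the process takes default values where the
  hitting times fail to decrease strictly to 0; comparing their measures therefore needs
  measurability of both.\<close>

lemma prob_death_process_gt:
  assumes "t > 0" "r \<ge> 0" "nat \<lfloor>r\<rfloor> \<ge> 1"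
  shows "prob {\<omega> \<in> space M. ereal_of_enat (death_process X t \<omega>) > ereal r} = prob {\<omega> \<in> space M. T (nat \<lfloor>r\<rfloor>) \<omega> > t}"
proof (rule measure_eq_AE)
  show "AE \<omega> in M. (\<omega> \<in> {\<omega> \<in> space M. ereal_of_enat (death_process X t \<omega>) > ereal r})
      = (\<omega> \<in> {\<omega> \<in> space M. T (nat \<lfloor>r\<rfloor>) \<omega> > t})"
    using AE_hitting_times
  proof eventually_elim
    case (elim \<omega>)
    then have "death_process X t \<omega> \<le> enat (nat \<lfloor>r\<rfloor>) \<longleftrightarrow> T (nat \<lfloor>r\<rfloor>) \<omega> \<le> t"
      using assms by (intro death_process_le_iff) auto
    then show ?case
      using assms by (simp only: ereal_of_enat_gt_iff mem_Collect_eq not_le[symmetric, of t])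
  qed
  have [measurable]: "random_variable borel (T (nat \<lfloor>r\<rfloor>))"
    using assms by (intro measurable_T)
  show "{\<omega> \<in> space M. T (nat \<lfloor>r\<rfloor>) \<omega> > t} \<in> events"
    by measurable
  have "death_process X t -` {z. ereal_of_enat z > ereal r} \<inter> space M \<in> events"
    by (rule measurable_sets[OF measurable_death_process]) simp
  also have "death_process X t -` {z. ereal_of_enat z > ereal r} \<inter> space M
      = {\<omega> \<in> space M. ereal_of_enat (death_process X t \<omega>) > ereal r}"
    by auto
  finally show "{\<omega> \<in> space M. ereal_of_enat (death_process X t \<omega>) > ereal r} \<in> events" .
qed

text \<open>Here a strict inequality for the state becomes a weak one for the hitting time, a case
  that the squeezed \<open>p\<close> of the tail estimates absorbs.\<close>

lemma prob_death_process_less: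
  assumes "t > 0" "r > 0" "nat \<lceil>r\<rceil> - 1 \<ge> 1"
  shows "prob {\<omega> \<in> space M. ereal_of_enat (death_process X t \<omega>) < ereal r} = prob {\<omega> \<in> space M. T (nat \<lceil>r\<rceil> - 1) \<omega> \<le> t}"
proof (rule measure_eq_AE)
  show "AE \<omega> in M. (\<omega> \<in> {\<omega> \<in> space M. ereal_of_enat (death_process X t \<omega>) < ereal r})
      = (\<omega> \<in> {\<omega> \<in> space M. T (nat \<lceil>r\<rceil> - 1) \<omega> \<le> t})"
    using AE_hitting_times
  proof eventually_elim
    case (elim \<omega>)
    then have "death_process X t \<omega> \<le> enat (nat \<lceil>r\<rceil> - 1) \<longleftrightarrow> T (nat \<lceil>r\<rceil> - 1) \<omega> \<le> t"
      using assms by (intro death_process_le_iff) auto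
    then show ?case
      using assms by (simp only: ereal_of_enat_less_iff mem_Collect_eq)
  qed
  have [measurable]: "random_variable borel (T (nat \<lceil>r\<rceil> - 1))"
    using assms by (intro measurable_T)
  show "{\<omega> \<in> space M. T (nat \<lceil>r\<rceil> - 1) \<omega> \<le> t} \<in> events"
    by measurable
  have "death_process X t -` {z. ereal_of_enat z < ereal r} \<inter> space M \<in> events"
    by (rule measurable_sets[OF measurable_death_process]) simp
  also have "death_process X t -` {z. ereal_of_enat z < ereal r} \<inter> space M
      = {\<omega> \<in> space M. ereal_of_enat (death_process X t \<omega>) < ereal r}"
    by auto
  finally show "{\<omega> \<in> space M. ereal_of_enat (death_process X t \<omega>) < ereal r} \<in> events" .
qed

lemma hitting_time_threshold:
  "((\<lambda>n. (x * A n) * rate n / real n) \<longlongrightarrow> x / (\<beta> - 1)) sequentially"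
  using tendsto_mult[OF tendsto_const[of x] A_asymptotics] by (simp add: mult.assoc)

text \<open>Changing the normalisation from \<open>m t\<close> to the speed multiplies the limit by
  \<open>x\<close>, the prefactor in \<open>J\<close>.\<close>

lemma rate_J_limit:
  fixes m :: "real \<Rightarrow> nat" and p :: "real \<Rightarrow> real"
  assumes "x > 0" and m: "\<And>t. \<bar>real (m t) - x * real (speed M X t)\<bar> \<le> 1"
    and lim: "((\<lambda>t. ln (p t) / real (m t)) \<longlongrightarrow> - rate_I \<beta> (x powr (\<beta> - 1))) (at_right 0)"
  shows "((\<lambda>t. ln (p t) / real (speed M X t)) \<longlongrightarrow> - rate_J \<beta> x) (at_right 0)"
proof -
  have "((\<lambda>t. real (m t) / real (speed M X t) * (ln (p t) / real (m t)))
      \<longlongrightarrow> - rate_J \<beta> x) (at_right 0)"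
    unfolding rate_J_def mult_minus_right[symmetric]
    by (rule tendsto_mult[OF scaled_speed_asymptotics(1)[OF \<open>x > 0\<close> m] lim])
  moreover have "\<forall>\<^sub>F t in at_right 0. m t \<ge> 1"
    using scaled_speed_asymptotics(2)[OF \<open>x > 0\<close> m] by (simp add: filterlim_at_top)
  then have "\<forall>\<^sub>F t in at_right 0. real (m t) / real (speed M X t) * (ln (p t) / real (m t)) = ln (p t) / real (speed M X t)"
    by eventually_elim simp
  ultimately show ?thesis
    by (rule Lim_transform_eventually)
qed

lemma death_process_upper_tail:
  assumes "x \<ge> 1"
  shows "((\<lambda>t. ln (prob {\<omega> \<in> space M. ereal_of_enat (death_process X t \<omega>) > ereal (x * real (speed M X t))})
    / real (speed M X t)) \<longlongrightarrow> - rate_J \<beta> x) (at_right 0)"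
proof -
  have "x > 0" using assms by simp
  define m where "m t = nat \<lfloor>x * real (speed M X t)\<rfloor>" for t
  have m: "\<bar>real (m t) - x * real (speed M X t)\<bar> \<le> 1" for t
  proof -
    have "x * real (speed M X t) \<ge> 0" using \<open>x > 0\<close> by simp
    then show ?thesis unfolding m_def by linarith
  qed
  note asym = scaled_speed_asymptotics[OF \<open>x > 0\<close> m]
  have ev: "\<forall>\<^sub>F t in at_right 0. prob {\<omega> \<in> space M. ereal_of_enat (death_process X t \<omega>) > ereal (x * real (speed M X t))}
      = prob {\<omega> \<in> space M. T (m t) \<omega> > t} \<and> m t \<ge> 1"
  proof -
    have "\<forall>\<^sub>F t in at_right 0. m t \<ge> 1"
      using asym(2) by (simp add: filterlim_at_top)
    with eventually_at_right_less[of 0] show ?thesis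
    proof eventually_elim
      case (elim t)
      then show ?case
        using prob_death_process_gt[of t "x * real (speed M X t)"] \<open>x > 0\<close> by (simp add: m_def)
    qed
  qed
  show ?thesis
  proof (rule rate_J_limit[OF \<open>x > 0\<close> m], rule hitting_time_upper_tail[OF asym(2) _ asym(3)])
    show "1 \<le> x powr (\<beta> - 1)"
      using assms beta by (intro ge_one_powr_ge_zero) auto
    show "\<forall>\<^sub>F t in at_right 0. prob {\<omega> \<in> space M. T (m t) \<omega> > t}
        \<le> prob {\<omega> \<in> space M. ereal_of_enat (death_process X t \<omega>) > ereal (x * real (speed M X t))}"
      using ev by eventually_elim simp
    show "\<forall>\<^sub>F t in at_right 0. prob {\<omega> \<in> space M. ereal_of_enat (death_process X t \<omega>) > ereal (x * real (speed M X t))}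
        \<le> prob {\<omega> \<in> space M. T (m t) \<omega> \<ge> t}"
      using ev
    proof eventually_elim
      case (elim t)
      then have [measurable]: "random_variable borel (T (m t))"
        by (intro measurable_T) simp
      have "prob {\<omega> \<in> space M. T (m t) \<omega> > t} \<le> prob {\<omega> \<in> space M. T (m t) \<omega> \<ge> t}"
        by (intro finite_measure_mono) auto
      then show ?case using elim by simp
    qed
  qed
qed

lemma death_process_lower_tail:
  assumes "0 < x" "x \<le> 1"
  shows "((\<lambda>t. ln (prob {\<omega> \<in> space M. ereal_of_enat (death_process X t \<omega>) < ereal (x * real (speed M X t))})
    / real (speed M X t)) \<longlongrightarrow> - rate_J \<beta> x) (at_right 0)"
proof -
  \<comment> \<open>The largest integer strictly below the threshold when the latter is positive.
    The unit error bound survives truncation at 0, so it holds for every \<open>t\<close>, also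
    where \<open>speed\<close> has no meaning.\<close>
  define m where "m t = nat \<lceil>x * real (speed M X t)\<rceil> - 1" for t
  have m: "\<bar>real (m t) - x * real (speed M X t)\<bar> \<le> 1" for t
  proof -
    have "x * real (speed M X t) \<ge> 0" using \<open>x > 0\<close> by simp
    then show ?thesis unfolding m_def by linarith
  qed
  note asym = scaled_speed_asymptotics[OF \<open>x > 0\<close> m]
  have ev: "\<forall>\<^sub>F t in at_right 0. prob {\<omega> \<in> space M. ereal_of_enat (death_process X t \<omega>) < ereal (x * real (speed M X t))}
      = prob {\<omega> \<in> space M. T (m t) \<omega> \<le> t} \<and> m t \<ge> 1"
  proof -
    have "\<forall>\<^sub>F t in at_right 0. m t \<ge> 1"
      using asym(2) by (simp add: filterlim_at_top)
    with eventually_at_right_less[of 0] show ?thesis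
    proof eventually_elim
      case (elim t)
      then have "x * real (speed M X t) > 0"
        using \<open>x > 0\<close> by (cases "speed M X t = 0") (auto simp: m_def)
      then show ?case
        using prob_death_process_less[of t "x * real (speed M X t)"] elim by (simp add: m_def)
    qed
  qed
  show ?thesis
  proof (rule rate_J_limit[OF \<open>x > 0\<close> m], rule hitting_time_lower_tail[OF asym(2) _ _ asym(3)])
    show "0 < x powr (\<beta> - 1)" using assms by simp
    show "x powr (\<beta> - 1) \<le> 1"
      using assms beta by (intro powr_le1) auto
    show "\<forall>\<^sub>F t in at_right 0. prob {\<omega> \<in> space M. T (m t) \<omega> < t}
        \<le> prob {\<omega> \<in> space M. ereal_of_enat (death_process X t \<omega>) < ereal (x * real (speed M X t))}"
      using ev
    proof eventually_elim
      case (elim t)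
      then have [measurable]: "random_variable borel (T (m t))"
        by (intro measurable_T) simp
      have "prob {\<omega> \<in> space M. T (m t) \<omega> < t} \<le> prob {\<omega> \<in> space M. T (m t) \<omega> \<le> t}"
        by (intro finite_measure_mono) auto
      then show ?case using elim by simp
    qed
    show "\<forall>\<^sub>F t in at_right 0. prob {\<omega> \<in> space M. ereal_of_enat (death_process X t \<omega>) < ereal (x * real (speed M X t))}
        \<le> prob {\<omega> \<in> space M. T (m t) \<omega> \<le> t}"
      using ev by eventually_elim simp
  qed
qed

lemma hitting_time_gt_limit:
  assumes "x \<ge> 1"
  shows "(\<lambda>n. ln (prob {\<omega> \<in> space M. T n \<omega> > x * A n}) / real n) \<longlonglongrightarrow> - rate_I \<beta> x"
proof (rule hitting_time_upper_tail[OF filterlim_ident assms hitting_time_threshold])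
  show "\<forall>\<^sub>F n in sequentially. prob {\<omega> \<in> space M. T n \<omega> > x * A n} \<le> prob {\<omega> \<in> space M. T n \<omega> \<ge> x * A n}"
    using eventually_ge_at_top[of 1]
  proof eventually_elim
    case (elim n)
    then have [measurable]: "random_variable borel (T n)"
      by (rule measurable_T)
    show ?case by (intro finite_measure_mono) auto
  qed
qed simp

lemma hitting_time_less_limit:
  assumes "0 < x" "x \<le> 1"
  shows "(\<lambda>n. ln (prob {\<omega> \<in> space M. T n \<omega> < x * A n}) / real n) \<longlonglongrightarrow> - rate_I \<beta> x"
proof (rule hitting_time_lower_tail[OF filterlim_ident assms hitting_time_threshold])
  show "\<forall>\<^sub>F n in sequentially. prob {\<omega> \<in> space M. T n \<omega> < x * A n} \<le> prob {\<omega> \<in> space M. T n \<omega> \<le> x * A n}"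
    using eventually_ge_at_top[of 1]
  proof eventually_elim
    case (elim n)
    then have [measurable]: "random_variable borel (T n)"
      by (rule measurable_T)
    show ?case by (intro finite_measure_mono) auto
  qed
qed simp

end

theorem theorem5:
  fixes M :: "'a measure" and X :: "nat \<Rightarrow> 'a \<Rightarrow> real"
    and \<beta> :: real and L :: "real \<Rightarrow> real"
  assumes "\<beta> > 1"
    and "slowly_varying L"
    and "prob_space M"
    and "prob_space.indep_vars M (\<lambda>_. borel) X {2..}"
    and "\<And>n. n \<ge> 2 \<Longrightarrow>
      distributed M lborel (X n) (exponential_density (real n powr \<beta> * L (real n)))"
  shows "(\<forall>x\<ge>1.
      ((\<lambda>n. ln (measure M {\<omega> \<in> space M. hitting_time X n \<omega> > x * mean_hitting_time M X n}) / real n)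
        \<longlonglongrightarrow> - rate_I \<beta> x) \<and>
      ((\<lambda>t. ln (measure M {\<omega> \<in> space M. ereal_of_enat (death_process X t \<omega>) > ereal (x * real (speed M X t))})
          / real (speed M X t)) \<longlongrightarrow> - rate_J \<beta> x) (at_right 0)) \<and>
    (\<forall>x. 0 < x \<and> x \<le> 1 \<longrightarrow>
      ((\<lambda>n. ln (measure M {\<omega> \<in> space M. hitting_time X n \<omega> < x * mean_hitting_time M X n}) / real n)
        \<longlonglongrightarrow> - rate_I \<beta> x) \<and>
      ((\<lambda>t. ln (measure M {\<omega> \<in> space M. ereal_of_enat (death_process X t \<omega>) < ereal (x * real (speed M X t))})
          / real (speed M X t)) \<longlongrightarrow> - rate_J \<beta> x) (at_right 0))"
proof -
  interpret prob_space M by fact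
  interpret R: regularly_varying_rates \<beta> L
    by unfold_locales fact+
  interpret pure_death M \<beta> L X
    by unfold_locales (use assms in \<open>auto simp: R.rate_def\<close>)
  show ?thesis
    using hitting_time_gt_limit death_process_upper_tail hitting_time_less_limit death_process_lower_tail
    by blast
qed

end
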